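(* Let $D\subset\mathbb{R}^k$ be measurable with $0<\mu_k(D)<\infty$, let $p\in\mathbb{R}^k$, $D_p=p+D$, $\tilde D=D\cup D_p$, where $D$ and $D_p$ have non-intersecting interiors, so that $\mu_k(\tilde D)=2\mu_k(D)$. Let $g:D\to\mathbb{R}$ be measurable with $g\ge 0$, and define $\psi_g:\tilde D\to\mathbb{R}$ by \[ \psi_g(x)=\begin{cases} g(x), & x\in D,\\ -g(x-p), & x\in D_p,\ x\notin D.\end{cases} \] Let $k_n\in\mathbb{Z}$ with $k_n=o(n)$ as $n\to\infty$, let $A(n)\in\mathbb{C}^{(\lceil n/2\rceil+k_n)\times(\lfloor n/2\rfloor-k_n)}$, and let $B_n,E_n\in\mathbb{C}^{n\times n}$ be Hermitian matrices such that \[ B_n=\begin{bmatrix} O_{\lceil n/2\rceil+k_n} & A(n)\\ A(n)^* & O_{\lfloor n/2\rfloor-k_n}\end{bmatrix}+E_n , \] where $O_q$ denotes the $q\times q$ null matrix. If $\{A(n)\}_n\sim_\sigma g$ and $\{E_n\}_n\sim_\sigma 0$, then \[ \{B_n\}_n\sim_\lambda \psi_g \] over the domain $\tilde D$.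
   Context: $\mu_k$ is Lebesgue measure on $\mathbb{R}^k$; $C_c(\mathbb{R})$ and $C_c(\mathbb{C})$ are the spaces of complex-valued continuous functions with bounded support on $\mathbb{R}$ and $\mathbb{C}$ respectively. Let $h:\Omega\subset\mathbb{R}^k\to\mathbb{C}$ be measurable with $0<\mu_k(\Omega)<\infty$. Eigenvalue distribution: for square matrices $X_n$ of size $n$, $\{X_n\}_n\sim_\lambda h$ (over $\Omega$) means that \[ \lim_{n\to\infty}\frac1n\sum_{j=1}^n F(\lambda_j(X_n))=\frac{1}{\mu_k(\Omega)}\int_\Omega F(h(x))\,dx\qquad\text{for all }F\in C_c(\mathbb{C}), \] where $\lambda_1(X_n),\dots,\lambda_n(X_n)$ are the eigenvalues of $X_n$ counted with multiplicity. Singular value distribution: $\{X_n\}_n\sim_\sigma h$ means that \[ \lim_{n\to\infty}\frac{1}{d_n}\sum_{j=1}^{d_n} F(\sigma_j(X_n))=\frac{1}{\mu_k(\Omega)}\int_\Omega F(|h(x)|)\,dx\qquad\text{for all }F\in C_c(\mathbb{R}), \] where $d_n$ is the number of singular values of $X_n$ (the minimum of its two dimensions, which equals $n$ for an $n\times n$ matrix) and $\sigma_1(X_n),\dots,\sigma_{d_n}(X_n)$ are these singular values. In particular $\{E_n\}_n\sim_\sigma 0$ means $\frac1n\sum_{j=1}^nF(\sigma_j(E_n))\to F(0)$ for all $F\in C_c(\mathbb{R})$. Since $k_n=o(n)$, the block sizes are positive for all sufficiently large $n$, which is all that matters for the asymptotic statements.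
   Formalization: The identity μ_k(D̃)=2μ_k(D) is assumed in addition to D and D_p having non-intersecting interiors, since for general measurable D it does not follow (D the irrationals of [0,1], p=0) and the claim then fails. *)

theory Defs
  imports "HOL-Analysis.Analysis" "HOL-Library.Landau_Symbols"
    "Jordan_Normal_Form.Schur_Decomposition"
begin

definition Cc :: "('a::metric_space \<Rightarrow> complex) set" where
  "Cc = {F. continuous_on UNIV F \<and> bounded {x. F x \<noteq> 0}}"

definition hermitian_mat :: "complex mat \<Rightarrow> bool" where
  "hermitian_mat X \<longleftrightarrow> square_mat X \<and> mat_adjoint X = X"

text \<open>Eigenvalues and singular values are multisets, so that multiplicities are counted.\<close>

definition eigenvalues :: "complex mat \<Rightarrow> complex multiset" where
  "eigenvalues X = proots (char_poly X)"

text \<open>The singular values of an \<open>r \<times> c\<close> matrix are the square roots of the eigenvalues of the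
  smaller of the two Gram matrices; this yields exactly \<open>min r c\<close> of them. The Gram matrix is
  positive semidefinite, so taking the real part of its eigenvalues loses nothing.\<close>

definition singular_values :: "complex mat \<Rightarrow> real multiset" where
  "singular_values X = image_mset (\<lambda>z. sqrt (Re z))
     (eigenvalues (if dim_col X \<le> dim_row X then mat_adjoint X * X else X * mat_adjoint X))"

text \<open>Both notions are meant for measurable \<open>h\<close> on a measurable \<open>\<Omega>\<close> of finite
  positive measure; \<open>eigenvalue_distr\<close> moreover for \<open>X n\<close> square of size \<open>n\<close>.\<close>

definition eigenvalue_distr ::
    "(nat \<Rightarrow> complex mat) \<Rightarrow> (real^'k) set \<Rightarrow> (real^'k \<Rightarrow> complex) \<Rightarrow> bool" where
  "eigenvalue_distr X \<Omega> h \<longleftrightarrow> (\<forall>F\<in>Cc.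
     (\<lambda>n. (\<Sum>z\<in>#eigenvalues (X n). F z) / of_nat n) \<longlonglongrightarrow>
       (LINT x|lebesgue_on \<Omega>. F (h x)) / of_real (measure lebesgue \<Omega>))"

definition singular_value_distr ::
    "(nat \<Rightarrow> complex mat) \<Rightarrow> (real^'k) set \<Rightarrow> (real^'k \<Rightarrow> complex) \<Rightarrow> bool" where
  "singular_value_distr X \<Omega> h \<longleftrightarrow> (\<forall>F\<in>Cc.
     (\<lambda>n. (\<Sum>s\<in>#singular_values (X n). F s) / of_nat (min (dim_row (X n)) (dim_col (X n)))) \<longlonglongrightarrow>
       (LINT x|lebesgue_on \<Omega>. F (cmod (h x))) / of_real (measure lebesgue \<Omega>))"

text \<open>Only the values on \<open>D \<union> (+) p ` D\<close> matter.\<close>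

definition psi :: "(real^'k) set \<Rightarrow> real^'k \<Rightarrow> (real^'k \<Rightarrow> real) \<Rightarrow> real^'k \<Rightarrow> real" where
  "psi D p g x = (if x \<in> D then g x else - g (x - p))"

end

theory Submission
  imports Defs
begin

text \<open>Let \<open>M\<close> be the Hermitian matrix with off-diagonal blocks \<open>A\<close> and \<open>A\<^sup>*\<close>, so that \<open>B = M + E\<close>.
  Multiplying \<open>X - M\<close> by a block triangular matrix shows that the eigenvalues of \<open>M\<close> are \<open>s\<close> and
  \<open>-s\<close> for the singular values \<open>s\<close> of \<open>A\<close>, together with \<open>\<bar>r - c\<bar> = o(n)\<close> zeros if \<open>A\<close> has
  \<open>r\<close> rows and \<open>c\<close> columns. So their distribution is that of \<open>g\<close> and \<open>-g\<close> on two copies of \<open>D\<close>, that is, of \<open>psi\<close>.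

  The singular values of the Hermitian matrix \<open>E\<close> are the moduli of its eigenvalues, hence for every
  \<open>h > 0\<close> only \<open>q = o(n)\<close> eigenvalues of \<open>E\<close> lie outside \<open>[-h, h]\<close>. By Weyl's inequality the
  counting functions of \<open>M\<close> and \<open>B\<close> then agree up to a shift of the argument by \<open>h\<close> and an error
  \<open>q\<close>. Averages of a continuous test function of compact support cannot see such a change in the
  limit.\<close>

unbundle no vec_syntax and no inner_syntax

section \<open>Hermitian matrices\<close>

lemma mat_adjoint_carrier [simp]: "A \<in> carrier_mat n m \<Longrightarrow> mat_adjoint A \<in> carrier_mat m n"
  unfolding mat_adjoint_def by (intro carrier_matI) auto

lemma dim_mat_adjoint [simp]:
  "dim_row (mat_adjoint A) = dim_col A" "dim_col (mat_adjoint A) = dim_row A"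
  by (simp_all add: mat_adjoint_def)

lemma index_mat_adjoint [simp]:
  "i < dim_col A \<Longrightarrow> j < dim_row A \<Longrightarrow> mat_adjoint A $$ (i, j) = conjugate (A $$ (j, i))"
  by (simp add: mat_adjoint_def mat_of_rows_index)

lemma mat_adjoint_adjoint [simp]: "mat_adjoint (mat_adjoint A) = A"
  by (rule eq_matI) auto

lemma index_mult_mat_sum:
  "i < dim_row A \<Longrightarrow> j < dim_col B \<Longrightarrow> dim_col A = dim_row B \<Longrightarrow>
    (A * B) $$ (i, j) = (\<Sum>k<dim_row B. A $$ (i, k) * B $$ (k, j))"
  by (simp add: scalar_prod_def atLeast0LessThan)

lemma mat_adjoint_mult:
  fixes A B :: "complex mat"
  assumes "A \<in> carrier_mat n m" "B \<in> carrier_mat m k"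
  shows "mat_adjoint (A * B) = mat_adjoint B * mat_adjoint A"
  using assms
  by (intro eq_matI) (auto simp: index_mult_mat_sum mult.commute simp del: index_mult_mat(1))

lemma cscalar_prod_sum: "v \<bullet>c w = (\<Sum>i<dim_vec w. v $ i * conjugate (w $ i))"
  by (simp add: scalar_prod_def atLeast0LessThan)

lemma mult_mat_vec_cscalar:
  fixes A :: "complex mat"
  assumes A: "A \<in> carrier_mat n m" and x: "x \<in> carrier_vec m" and y: "y \<in> carrier_vec n"
  shows "(A *\<^sub>v x) \<bullet>c y = x \<bullet>c (mat_adjoint A *\<^sub>v y)"
proof -
  have "(A *\<^sub>v x) \<bullet>c y = (\<Sum>i<n. \<Sum>j<m. A $$ (i, j) * x $ j * conjugate (y $ i))"
    using A x y by (simp add: cscalar_prod_sum scalar_prod_def atLeast0LessThan sum_distrib_right)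
  also have "\<dots> = (\<Sum>j<m. \<Sum>i<n. A $$ (i, j) * x $ j * conjugate (y $ i))"
    by (rule sum.swap)
  also have "\<dots> = x \<bullet>c (mat_adjoint A *\<^sub>v y)"
    using A x y by (simp add: cscalar_prod_sum scalar_prod_def atLeast0LessThan sum_distrib_left mult_ac)
  finally show ?thesis .
qed

definition real_diag_mat :: "nat \<Rightarrow> (nat \<Rightarrow> real) \<Rightarrow> complex mat" where
  "real_diag_mat n l = mat n n (\<lambda>(i, j). if i = j then of_real (l i) else 0)"

lemma real_diag_mat_carrier [simp]: "real_diag_mat n l \<in> carrier_mat n n"
  by (simp add: real_diag_mat_def)

lemma dim_real_diag_mat [simp]: "dim_row (real_diag_mat n l) = n" "dim_col (real_diag_mat n l) = n"
  by (simp_all add: real_diag_mat_def)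

text \<open>The spectral decomposition, with the eigenvalues given by the real values of
  \<open>l\<close> below \<open>n\<close>. Indexing them by numbers turns eigenvalue counts into
  cardinalities of index sets.\<close>

definition unitarily_diag :: "nat \<Rightarrow> complex mat \<Rightarrow> complex mat \<Rightarrow> (nat \<Rightarrow> real) \<Rightarrow> bool" where
  "unitarily_diag n A U l \<longleftrightarrow> U \<in> carrier_mat n n \<and> mat_adjoint U * U = 1\<^sub>m n \<and>
     U * mat_adjoint U = 1\<^sub>m n \<and> A = U * real_diag_mat n l * mat_adjoint U"

lemma unitarily_diagD:
  assumes "unitarily_diag n A U l"
  shows "U \<in> carrier_mat n n" "mat_adjoint U * U = 1\<^sub>m n" "U * mat_adjoint U = 1\<^sub>m n"
    "A = U * real_diag_mat n l * mat_adjoint U" "A \<in> carrier_mat n n"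
  using assms by (auto simp: unitarily_diag_def)

text \<open>A left inverse of a square matrix is also a right inverse, which supplies the second
  unitarity identity and lets \<open>A\<close> be recovered from its conjugate.\<close>

lemma unitarily_diagI:
  assumes U: "U \<in> carrier_mat n n" and UU: "mat_adjoint U * U = 1\<^sub>m n"
    and A: "A \<in> carrier_mat n n" and D: "mat_adjoint U * A * U = real_diag_mat n l"
  shows "unitarily_diag n A U l"
proof -
  have UU': "U * mat_adjoint U = 1\<^sub>m n"
    using U UU mat_mult_left_right_inverse[of "mat_adjoint U" n U] by simp
  have "U * (mat_adjoint U * A * U) * mat_adjoint U = (U * mat_adjoint U) * A * (U * mat_adjoint U)"
    using U A by (simp add: assoc_mult_mat[of _ n n _ n _ n] mult_carrier_mat[of _ n n _ n])
  then show ?thesis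
    using U UU UU' A D by (simp add: unitarily_diag_def)
qed

section \<open>The spectral theorem\<close>

lemma exists_eigenvector:
  fixes A :: "complex mat"
  assumes A: "A \<in> carrier_mat n n" and n: "0 < n"
  obtains e v where "v \<in> carrier_vec n" "v \<noteq> 0\<^sub>v n" "A *\<^sub>v v = e \<cdot>\<^sub>v v"
proof -
  obtain as where as: "char_poly A = (\<Prod>a\<leftarrow>as. [:- a, 1:])" "length as = n"
    using char_poly_factorized[OF A] by blast
  then obtain e es where "as = e # es"
    using n by (cases as) auto
  then have "eigenvalue A e"
    using as by (simp add: eigenvalue_root_char_poly[OF A])
  then show thesis
    using that A by (auto simp: eigenvalue_def eigenvector_def)
qed

text \<open>Complete \<open>v\<close> to a basis and orthogonalize: Gram-Schmidt keeps the first
  vector, and scaling the columns to length one makes the matrix unitary. Only the direction of the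
  first column matters later, so \<open>c\<close> stays unspecified.\<close>

lemma unitary_with_first_column:
  fixes v :: "complex vec"
  assumes v: "v \<in> carrier_vec n" "v \<noteq> 0\<^sub>v n"
  obtains U c where "U \<in> carrier_mat n n" "mat_adjoint U * U = 1\<^sub>m n" "col U 0 = c \<cdot>\<^sub>v v"
proof -
  interpret cof_vec_space n "TYPE(complex)" .
  define ws where "ws = gram_schmidt n (basis_completion v)"
  note bc = basis_completion[OF v]
  note gs = gram_schmidt_result[OF bc(2,4,5) ws_def]
  have len: "length ws = n"
    using gs(4) bc(6) by simp
  have n: "0 < n"
    using v by (cases n) auto
  have hd: "ws ! 0 = v"
  proof -
    obtain vs where "basis_completion v = v # vs"
      using bc(6,7) n by (cases "basis_completion v") auto
    then have "hd ws = v"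
      using v(1) by (simp add: ws_def)
    then show ?thesis
      using len n by (metis hd_conv_nth length_0_conv less_irrefl)
  qed
  have wsc: "ws ! i \<in> carrier_vec n" if "i < n" for i
    using gs(3) len that nth_mem by blast
  define r where "r w = complex_of_real (1 / sqrt (Re (w \<bullet>c w)))" for w :: "complex vec"
  have cnj_r: "conjugate (r w) = r w" for w
    by (simp add: r_def)
  define U where "U = mat n n (\<lambda>(i, j). r (ws ! j) * (ws ! j $ i))"
  have U: "U \<in> carrier_mat n n"
    by (simp add: U_def)
  have "(mat_adjoint U * U) $$ (i, j) = 1\<^sub>m n $$ (i, j)" if ij: "i < n" "j < n" for i j
  proof -
    have "(mat_adjoint U * U) $$ (i, j) = (\<Sum>k<n. conjugate (r (ws ! i)) * conjugate (ws ! i $ k) * (r (ws ! j) * ws ! j $ k))"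
      using ij U by (subst index_mult_mat_sum) (auto simp: U_def)
    also have "\<dots> = r (ws ! i) * r (ws ! j) * (ws ! j \<bullet>c ws ! i)"
      using wsc[OF ij(1)] by (simp add: cscalar_prod_sum sum_distrib_left cnj_r mult_ac del: conjugate_complex_def)
    also have "\<dots> = (if i = j then 1 else 0)"
    proof (cases "i = j")
      case True
      have "ws ! i \<bullet>c ws ! i \<noteq> 0"
        using corthogonalD[OF gs(2), of i i] ij len by auto
      moreover have ge: "ws ! i \<bullet>c ws ! i \<ge> 0"
        by (rule conjugate_square_ge_0_vec)
      moreover define \<rho> where "\<rho> = Re (ws ! i \<bullet>c ws ! i)"
      ultimately have "0 < \<rho>" and \<rho>: "ws ! i \<bullet>c ws ! i = of_real \<rho>"
        by (auto simp: less_eq_complex_def complex_eq_iff)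
      then have "1 / sqrt \<rho> * (1 / sqrt \<rho>) * \<rho> = 1"
        by simp
      then have "r (ws ! i) * r (ws ! i) * of_real \<rho> = 1"
        unfolding r_def \<rho> Re_complex_of_real by (metis of_real_1 of_real_mult)
      then show ?thesis
        using True \<rho> by simp
    next
      case False
      then show ?thesis
        using corthogonalD[OF gs(2), of j i] ij len by auto
    qed
    finally show ?thesis
      using ij by simp
  qed
  then have "mat_adjoint U * U = 1\<^sub>m n"
    using U by (intro eq_matI) auto
  moreover have "col U 0 = r v \<cdot>\<^sub>v v"
    using n v(1) hd by (intro eq_vecI) (auto simp: U_def)
  ultimately show thesis
    using that U by blast
qed

lemma hermitian_mat_conjugation:
  assumes "hermitian_mat A" "A \<in> carrier_mat n n" "U \<in> carrier_mat n m"
  shows "hermitian_mat (mat_adjoint U * A * U)"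
proof -
  have UA: "mat_adjoint U * A \<in> carrier_mat m n"
    using assms by (simp add: mult_carrier_mat[of _ m n])
  have "mat_adjoint (mat_adjoint U * A * U) = mat_adjoint U * (mat_adjoint (mat_adjoint U * A))"
    by (rule mat_adjoint_mult[OF UA assms(3)])
  also have "mat_adjoint (mat_adjoint U * A) = mat_adjoint A * U"
    using mat_adjoint_mult[of "mat_adjoint U" m n A n] assms by simp
  finally show ?thesis
    using assms by (auto simp: hermitian_mat_def assoc_mult_mat[of _ m n _ n _ m])
qed

text \<open>Deflation, by induction on the size: in an orthonormal basis starting with an
  eigenvector, the first column of the matrix vanishes below the diagonal, hence by symmetry so does
  the first row beyond it, and a smaller Hermitian block \<open>C'\<close> remains.\<close>

theorem hermitian_unitarily_diag:
  assumes "A \<in> carrier_mat n n" "hermitian_mat A"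
  shows "\<exists>U l. unitarily_diag n A U l"
  using assms
proof (induction n arbitrary: A)
  case 0
  have "unitarily_diag 0 A (1\<^sub>m 0) (\<lambda>_. 0)"
    using 0 by (intro unitarily_diagI eq_matI) auto
  then show ?case by blast
next
  case (Suc m)
  let ?n = "Suc m"
  note A = Suc.prems(1)
  obtain e v where v: "v \<in> carrier_vec ?n" "v \<noteq> 0\<^sub>v ?n" and ev: "A *\<^sub>v v = e \<cdot>\<^sub>v v"
    using exists_eigenvector[OF A zero_less_Suc] by blast
  obtain W c where W: "W \<in> carrier_mat ?n ?n" and WW: "mat_adjoint W * W = 1\<^sub>m ?n"
    and col: "col W 0 = c \<cdot>\<^sub>v v"
    using unitary_with_first_column[OF v] by blast
  define C where "C = mat_adjoint W * A * W"
  have C: "C \<in> carrier_mat ?n ?n"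
    unfolding C_def using A W by (intro mult_carrier_mat[of _ ?n ?n]) simp_all
  have Cherm: "mat_adjoint C = C"
    using hermitian_mat_conjugation[OF Suc.prems(2) A W] by (simp add: C_def hermitian_mat_def)
  have herm: "C $$ (j, i) = cnj (C $$ (i, j))" if "i < ?n" "j < ?n" for i j
    using index_mat_adjoint[of j C i] that C unfolding Cherm by simp
  have "col (A * W) 0 = e \<cdot>\<^sub>v col W 0"
  proof -
    have "col (A * W) 0 = A *\<^sub>v col W 0"
      using A W by (intro eq_vecI) auto
    also have "\<dots> = e \<cdot>\<^sub>v col W 0"
      using A v ev by (simp add: col mult_mat_vec smult_smult_assoc mult.commute)
    finally show ?thesis .
  qed
  \<comment> \<open>Column 0 of \<open>W\<close> is an eigenvector, so column 0 of \<open>C\<close>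
    is \<open>e\<close> times column 0 of \<open>mat_adjoint W * W\<close>, the identity
    matrix.\<close>
  then have "C $$ (i, 0) = e * (mat_adjoint W * W) $$ (i, 0)" if "i < ?n" for i
    using A W that by (simp add: C_def assoc_mult_mat[of _ ?n ?n _ ?n _ ?n] mult_carrier_mat[of _ ?n ?n _ ?n])
  then have C0: "C $$ (i, 0) = (if i = 0 then e else 0)" if "i < ?n" for i
    using that by (simp add: WW)
  have C0': "C $$ (0, j) = (if j = 0 then e else 0)" if "j < ?n" for j
    using herm[of j 0] C0[OF that] C0[of 0] herm[of 0 0] that by (auto split: if_splits)
  have "cnj e = e"
    using herm[of 0 0] C0[of 0] by simp
  then obtain e' where e': "e = of_real e'"
    by (metis Reals_cnj_iff Reals_cases)
  define C' where "C' = mat m m (\<lambda>(i, j). C $$ (Suc i, Suc j))"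
  have C': "C' \<in> carrier_mat m m"
    by (simp add: C'_def)
  have "hermitian_mat C'"
    unfolding hermitian_mat_def
  proof
    show "mat_adjoint C' = C'"
    proof (rule eq_matI)
      fix i j assume "i < dim_row C'" "j < dim_col C'"
      then show "mat_adjoint C' $$ (i, j) = C' $$ (i, j)"
        using herm[of "Suc j" "Suc i"] by (simp add: C'_def)
    qed (simp_all add: C'_def)
  qed (simp add: C'_def)
  from Suc.IH[OF C' this] obtain U l where Ul: "unitarily_diag m C' U l"
    by blast
  note U = unitarily_diagD[OF Ul]
  let ?Z = "0\<^sub>m 1 m" and ?Z' = "0\<^sub>m m 1" and ?E = "mat 1 1 (\<lambda>_. e)"
  have Cblock: "C = four_block_mat ?E ?Z ?Z' C'"
    using C C0 C0' by (intro eq_matI) (auto simp: C'_def)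
  \<comment> \<open>Bordering the diagonalizer of \<open>C'\<close> by a 1 leaves the eigenvector
    already found untouched; \<open>W * V\<close> then diagonalizes \<open>A\<close>.\<close>
  define V where "V = four_block_mat (1\<^sub>m 1) ?Z ?Z' U"
  have V: "V \<in> carrier_mat ?n ?n"
    using U(1) by (auto simp: V_def intro: four_block_carrier_mat)
  have Vadj: "mat_adjoint V = four_block_mat (1\<^sub>m 1) ?Z ?Z' (mat_adjoint U)"
    using U(1) by (intro eq_matI) (auto simp: V_def)
  define l' where "l' i = (case i of 0 \<Rightarrow> e' | Suc i \<Rightarrow> l i)" for i
  have "mat_adjoint U * C' * U = real_diag_mat m l"
  proof -
    have "mat_adjoint U * C' * U = (mat_adjoint U * U) * real_diag_mat m l * (mat_adjoint U * U)"
      unfolding U(4) using U(1) by (simp add: assoc_mult_mat[of _ m m _ m _ m] mult_carrier_mat[of _ m m _ m])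
    then show ?thesis
      using U(2) by simp
  qed
  then have VCV: "mat_adjoint V * C * V = four_block_mat ?E ?Z ?Z' (real_diag_mat m l)"
    unfolding Vadj unfolding Cblock V_def using U(1) C'
    by (simp add: mult_four_block_mat[of _ 1 1 _ m _ m _ _ 1 _ m] mult_carrier_mat[of _ m m _ m] del: One_nat_def)
  have "mat_adjoint V * C * V = real_diag_mat ?n l'"
    unfolding VCV by (intro eq_matI) (auto simp: real_diag_mat_def l'_def e' split: nat.split)
  moreover have "mat_adjoint (W * V) * A * (W * V) = mat_adjoint V * C * V"
    using V W A by (simp add: mat_adjoint_mult[of _ ?n ?n _ ?n] C_def assoc_mult_mat[of _ ?n ?n _ ?n _ ?n] mult_carrier_mat[of _ ?n ?n _ ?n])
  moreover have "mat_adjoint (W * V) * (W * V) = 1\<^sub>m ?n"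
  proof -
    have "mat_adjoint (W * V) * (W * V) = mat_adjoint V * (mat_adjoint W * W) * V"
      using V W by (simp add: mat_adjoint_mult[of _ ?n ?n _ ?n] assoc_mult_mat[of _ ?n ?n _ ?n _ ?n] mult_carrier_mat[of _ ?n ?n _ ?n])
    also have "\<dots> = mat_adjoint V * V"
      using V by (simp add: WW)
    also have "\<dots> = four_block_mat (1\<^sub>m 1) ?Z ?Z' (1\<^sub>m m)"
      unfolding Vadj unfolding V_def using U(1,2) by (simp add: mult_four_block_mat[of _ 1 1 _ m _ m _ _ 1 _ m] mult_carrier_mat[of _ m m _ m] del: One_nat_def)
    also have "\<dots> = 1\<^sub>m ?n"
      by (intro eq_matI) auto
    finally show ?thesis .
  qed
  ultimately have "unitarily_diag ?n A (W * V) l'"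
    using V W A by (intro unitarily_diagI) auto
  then show ?case by blast
qed

section \<open>Eigenvalues and quadratic forms from a diagonalization\<close>

lemma unitarily_diag_similar:
  assumes "unitarily_diag n A U l"
  shows "similar_mat A (real_diag_mat n l)"
  unfolding similar_mat_def
  using unitarily_diagD[OF assms]
  by (intro exI[of _ U] exI[of _ "mat_adjoint U"] similar_mat_witI[of _ _ n]) auto

lemma unitarily_diag_char_poly:
  assumes "unitarily_diag n G U l"
  shows "char_poly G = (\<Prod>i\<leftarrow>[0..<n]. [:- of_real (l i), 1:])"
proof -
  have "diag_mat (real_diag_mat n l) = map (\<lambda>i. of_real (l i)) [0..<n]"
    by (auto simp: diag_mat_def real_diag_mat_def)
  moreover have "upper_triangular (real_diag_mat n l)"
    by (auto simp: real_diag_mat_def)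
  ultimately show ?thesis
    using char_poly_similar[OF unitarily_diag_similar[OF assms]]
      char_poly_upper_triangular[OF real_diag_mat_carrier]
    by (simp add: o_def)
qed

lemma unitarily_diag_eigenvalues:
  assumes "unitarily_diag n A U l"
  shows "eigenvalues A = image_mset (\<lambda>i. of_real (l i)) (mset [0..<n])"
proof -
  have "proots (\<Prod>i\<leftarrow>is. [:- complex_of_real (l i), 1:]) = image_mset (\<lambda>i. of_real (l i)) (mset is)" for "is"
  proof (induction "is")
    case (Cons i "is")
    have "(\<Prod>i\<leftarrow>is. [:- complex_of_real (l i), 1:]) \<noteq> 0"
      by auto
    then show ?case
      using Cons.IH proots_linear_factor[of "- complex_of_real (l i)"]
      by (simp add: proots_mult del: mult_pCons_left prod_list_zero_iff)
  qed simp
  then show ?thesis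
    by (simp only: eigenvalues_def unitarily_diag_char_poly[OF assms])
qed

lemma sum_mset_upt: "(\<Sum>i\<in>#mset [0..<n]. f i) = (\<Sum>i<n. f i)"
  by (metis atLeast_upt mset_map sum_mset_sum_list sum_list_distinct_conv_sum_set distinct_upt)

lemma unitarily_diag_uminus:
  assumes "unitarily_diag n A U l"
  shows "unitarily_diag n (- A) U (\<lambda>i. - l i)"
proof -
  note U = unitarily_diagD[OF assms]
  have "real_diag_mat n (\<lambda>i. - l i) = - real_diag_mat n l"
    by (intro eq_matI) (auto simp: real_diag_mat_def)
  moreover have "mat_adjoint U * A * U = real_diag_mat n l"
  proof -
    have "mat_adjoint U * A * U = (mat_adjoint U * U) * real_diag_mat n l * (mat_adjoint U * U)"
      unfolding U(4) using U(1)
      by (simp add: assoc_mult_mat[of _ n n _ n _ n] mult_carrier_mat[of _ n n _ n])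
    then show ?thesis
      using U(2) by simp
  qed
  moreover have "mat_adjoint U * (- A) * U = - (mat_adjoint U * A * U)"
    using U by simp
  ultimately show ?thesis
    using U by (intro unitarily_diagI) auto
qed

text \<open>\<open>y\<close> lists the coordinates of \<open>x\<close> in the orthonormal eigenbasis
  formed by the columns of \<open>U\<close>; in them the form is diagonal and the norm is
  preserved.\<close>

lemma unitarily_diag_quadratic_form:
  assumes "unitarily_diag n A U l" and x: "x \<in> carrier_vec n"
  defines "y \<equiv> mat_adjoint U *\<^sub>v x"
  shows "Re ((A *\<^sub>v x) \<bullet>c x) = (\<Sum>i<n. l i * (cmod (y $ i))\<^sup>2)"
    and "Re (x \<bullet>c x) = (\<Sum>i<n. (cmod (y $ i))\<^sup>2)"
    and "x = U *\<^sub>v y"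
proof -
  note U = unitarily_diagD[OF assms(1)]
  let ?D = "real_diag_mat n l"
  have y: "y \<in> carrier_vec n"
    using x U(1) by (simp add: y_def mult_mat_vec_carrier[of _ n n])
  show xUy: "x = U *\<^sub>v y"
    using U(1,3) x by (simp add: y_def flip: assoc_mult_mat_vec[of _ n n _ n])
  have "A *\<^sub>v x = U *\<^sub>v (?D *\<^sub>v y)"
    unfolding U(4) y_def using U(1) x
    by (simp add: assoc_mult_mat_vec[of _ n n _ n] mult_carrier_mat[of _ n n _ n] mult_mat_vec_carrier[of _ n n])
  then have "(A *\<^sub>v x) \<bullet>c x = (?D *\<^sub>v y) \<bullet>c y"
    using mult_mat_vec_cscalar[OF U(1) _ x] y by (simp add: y_def[symmetric] mult_mat_vec_carrier[of _ n n])
  also have "\<dots> = (\<Sum>i<n. of_real (l i) * (y $ i * cnj (y $ i)))"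
  proof -
    have "(?D *\<^sub>v y) $ i = of_real (l i) * y $ i" if "i < n" for i
      using that y by (simp add: real_diag_mat_def scalar_prod_def if_distrib[of "\<lambda>z. z * _"] cong: if_cong)
    then show ?thesis
      using y by (simp add: cscalar_prod_sum mult_ac)
  qed
  finally show "Re ((A *\<^sub>v x) \<bullet>c x) = (\<Sum>i<n. l i * (cmod (y $ i))\<^sup>2)"
    by (simp add: complex_mult_cnj cmod_power2)
  have "x \<bullet>c x = (U *\<^sub>v y) \<bullet>c x"
    using xUy by simp
  also have "\<dots> = y \<bullet>c y"
    using mult_mat_vec_cscalar[OF U(1) y x] by (simp add: y_def[symmetric])
  finally show "Re (x \<bullet>c x) = (\<Sum>i<n. (cmod (y $ i))\<^sup>2)"
    using y by (simp add: cscalar_prod_sum complex_mult_cnj cmod_power2 flip: power2_eq_square)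
qed

text \<open>The terms with \<open>s < l i\<close> drop out of the diagonalized form, and every
  remaining weight is at most \<open>s\<close>.\<close>

lemma unitarily_diag_quadratic_form_le:
  assumes U: "unitarily_diag n A U l" and x: "x \<in> carrier_vec n"
    and 0: "\<And>i. i < n \<Longrightarrow> s < l i \<Longrightarrow> (mat_adjoint U *\<^sub>v x) $ i = 0"
  shows "Re ((A *\<^sub>v x) \<bullet>c x) \<le> s * Re (x \<bullet>c x)"
  unfolding unitarily_diag_quadratic_form(1,2)[OF U x] sum_distrib_left
proof (rule sum_mono)
  fix i assume "i \<in> {..<n}"
  then have "s < l i \<Longrightarrow> cmod ((mat_adjoint U *\<^sub>v x) $ i) = 0"
    using 0 by (simp only: lessThan_iff norm_zero)
  moreover have "l i * c\<^sup>2 \<le> s * c\<^sup>2" if "s < l i \<Longrightarrow> c = 0" for c :: real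
    using that by (cases "s < l i") (simp_all add: mult_right_mono)
  ultimately show "l i * (cmod ((mat_adjoint U *\<^sub>v x) $ i))\<^sup>2 \<le> s * (cmod ((mat_adjoint U *\<^sub>v x) $ i))\<^sup>2"
    by blast
qed

text \<open>Only weights above \<open>s\<close> survive. Strictness comes from a nonzero coordinate,
  which exists because \<open>U\<close> maps the coordinate vector back to \<open>x\<close>.\<close>

lemma unitarily_diag_quadratic_form_gt:
  assumes U: "unitarily_diag n A U l" and x: "x \<in> carrier_vec n" "x \<noteq> 0\<^sub>v n"
    and 0: "\<And>i. i < n \<Longrightarrow> l i \<le> s \<Longrightarrow> (mat_adjoint U *\<^sub>v x) $ i = 0"
  shows "s * Re (x \<bullet>c x) < Re ((A *\<^sub>v x) \<bullet>c x)"
proof -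
  let ?y = "mat_adjoint U *\<^sub>v x"
  have "\<exists>i<n. ?y $ i \<noteq> 0"
  proof (rule ccontr)
    assume "\<not> (\<exists>i<n. ?y $ i \<noteq> 0)"
    then have "?y = 0\<^sub>v n"
      using unitarily_diagD(1)[OF U] by (intro eq_vecI) auto
    then have "x = 0\<^sub>v n"
      using unitarily_diag_quadratic_form(3)[OF U x(1)] unitarily_diagD(1)[OF U] by auto
    then show False
      using x by simp
  qed
  then obtain i where i: "i < n" "?y $ i \<noteq> 0"
    by blast
  show ?thesis
    unfolding unitarily_diag_quadratic_form(1,2)[OF U x(1)] sum_distrib_left
  proof (rule sum_strict_mono_ex1)
    show "\<forall>i\<in>{..<n}. s * (cmod (?y $ i))\<^sup>2 \<le> l i * (cmod (?y $ i))\<^sup>2"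
    proof
      fix i assume "i \<in> {..<n}"
      then have "l i \<le> s \<Longrightarrow> cmod (?y $ i) = 0"
        using 0 by (simp only: lessThan_iff norm_zero)
      moreover have "s * c\<^sup>2 \<le> l i * c\<^sup>2" if "l i \<le> s \<Longrightarrow> c = 0" for c :: real
        using that by (cases "l i \<le> s") (simp_all add: mult_right_mono)
      ultimately show "s * (cmod (?y $ i))\<^sup>2 \<le> l i * (cmod (?y $ i))\<^sup>2"
        by blast
    qed
    have "s < l i"
      using i 0[OF i(1)] by fastforce
    moreover have "0 < (cmod (?y $ i))\<^sup>2"
      using i(2) by (simp only: zero_less_power2 norm_eq_zero not_False_eq_True)
    ultimately show "\<exists>i\<in>{..<n}. s * (cmod (?y $ i))\<^sup>2 < l i * (cmod (?y $ i))\<^sup>2"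
      using i(1) mult_strict_right_mono by blast
  qed simp
qed

section \<open>Weyl's inequality and eigenvalue sums\<close>

text \<open>Padding the equations with zero rows gives a singular square matrix, and any nonzero
  kernel vector solves them. The product is bilinear, without conjugation, so that rows of an
  adjoint can be inserted directly.\<close>

lemma exists_orthogonal_vec:
  fixes rs :: "'a::field vec list"
  assumes rs: "set rs \<subseteq> carrier_vec n" and len: "length rs < n"
  shows "\<exists>x\<in>carrier_vec n. x \<noteq> 0\<^sub>v n \<and> (\<forall>r\<in>set rs. r \<bullet> x = 0)"
proof -
  define m where "m = length rs"
  define rs' where "rs' = rs @ replicate (n - m) (0\<^sub>v n)"
  have len': "length rs' = n"
    using len by (simp add: rs'_def m_def)
  have rs': "rs' ! i \<in> carrier_vec n" if "i < n" for i
    using that rs len by (auto simp: rs'_def m_def nth_append)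
  define M where "M = mat_of_rows n rs'"
  have M: "M \<in> carrier_mat n n"
    using len' by (auto simp: M_def)
  \<comment> \<open>Row \<open>m\<close> is the first padded row, hence zero, so the transpose
    annihilates the unit vector with index \<open>m\<close>.\<close>
  have "transpose_mat M *\<^sub>v unit_vec n m = 0\<^sub>v n"
  proof (rule eq_vecI)
    fix i assume i: "i < dim_vec (0\<^sub>v n :: 'a vec)"
    have "(transpose_mat M *\<^sub>v unit_vec n m) $ i = M $$ (m, i)"
      using i M len by (simp add: m_def)
    also have "\<dots> = 0"
      using i len len' by (simp add: M_def mat_of_rows_index rs'_def m_def nth_append)
    finally show "(transpose_mat M *\<^sub>v unit_vec n m) $ i = 0\<^sub>v n $ i"
      using i by simp
  qed (use M in auto)
  moreover have "unit_vec n m \<noteq> (0\<^sub>v n :: 'a vec)" "unit_vec n m \<in> carrier_vec n"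
    using len by (auto simp: m_def)
  ultimately have "det (transpose_mat M) = 0"
    unfolding det_0_iff_vec_prod_zero_field[OF transpose_carrier_mat[THEN iffD2, OF M]] by blast
  then have "det M = 0"
    using det_transpose[OF M] by simp
  then obtain x where x: "x \<in> carrier_vec n" "x \<noteq> 0\<^sub>v n" "M *\<^sub>v x = 0\<^sub>v n"
    using det_0_iff_vec_prod_zero_field[OF M] by blast
  have "r \<bullet> x = 0" if "r \<in> set rs" for r
  proof -
    from that obtain i where i: "i < length rs" "r = rs ! i"
      by (metis in_set_conv_nth)
    then have "row M i = r"
      using len len' rs'[of i] by (simp add: M_def) (simp add: rs'_def nth_append)
    then have "(M *\<^sub>v x) $ i = r \<bullet> x"
      using i len M by simp
    then show ?thesis
      using x(3) i len by simp
  qed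
  then show ?thesis
    using x by blast
qed

text \<open>If the inequality failed, fewer than \<open>n\<close> linear conditions would
  express that \<open>x\<close> lies in the spectral subspaces of \<open>A\<close> for \<open>(-\<infinity>, s]\<close>, of \<open>B\<close> for
  \<open>(-\<infinity>, t]\<close> and of \<open>A + B\<close> for \<open>(s + t, \<infinity>)\<close>.\<close>

lemma weyl_count:
  assumes A: "unitarily_diag n A U a" and B: "unitarily_diag n B V b"
    and C: "unitarily_diag n (A + B) W c"
  shows "card {i. i < n \<and> s + t < c i} \<le> card {i. i < n \<and> s < a i} + card {i. i < n \<and> t < b i}"
proof (rule ccontr)
  define I where "I f P = filter (\<lambda>i. P (f i)) [0..<n]" for f :: "nat \<Rightarrow> real" and P
  have len: "length (I f P) = card {i. i < n \<and> P (f i)}" for f P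
  proof -
    have "length (I f P) = card (set (I f P))"
      unfolding I_def by (rule distinct_card[symmetric]) simp
    also have "set (I f P) = {i. i < n \<and> P (f i)}"
      by (auto simp: I_def)
    finally show ?thesis .
  qed
  have compl: "card {i. i < n \<and> c i \<le> s + t} = n - card {i. i < n \<and> s + t < c i}"
  proof -
    have "{i. i < n \<and> c i \<le> s + t} = {..<n} - {i. i < n \<and> s + t < c i}"
      by auto
    moreover have sub: "{i. i < n \<and> s + t < c i} \<subseteq> {..<n}"
      by auto
    ultimately show ?thesis
      using card_Diff_subset[OF finite_subset[OF sub finite_lessThan] sub] by simp
  qed
  have le: "card {i. i < n \<and> s + t < c i} \<le> n"
    using card_mono[of "{..<n}" "{i. i < n \<and> s + t < c i}"] by auto
  note carr = unitarily_diagD(1)[OF A] unitarily_diagD(1)[OF B] unitarily_diagD(1)[OF C]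
  \<comment> \<open>The product of row \<open>i\<close> of \<open>mat_adjoint U\<close> with
    \<open>x\<close> is the coordinate of \<open>x\<close> along the eigenvector with index
    \<open>i\<close>, so orthogonality to \<open>rs\<close> removes exactly the unwanted
    coordinates.\<close>
  define rs where "rs = map (row (mat_adjoint U)) (I a (\<lambda>z. s < z)) @
    map (row (mat_adjoint V)) (I b (\<lambda>z. t < z)) @ map (row (mat_adjoint W)) (I c (\<lambda>z. z \<le> s + t))"
  assume "\<not> ?thesis"
  then have "length rs < n"
    using compl le by (simp add: rs_def len)
  moreover have "set rs \<subseteq> carrier_vec n"
    using carr by (auto simp: rs_def I_def)
  ultimately obtain x where x: "x \<in> carrier_vec n" "x \<noteq> 0\<^sub>v n" and 0: "\<And>r. r \<in> set rs \<Longrightarrow> r \<bullet> x = 0"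
    using exists_orthogonal_vec by blast
  have "Re ((A *\<^sub>v x) \<bullet>c x) \<le> s * Re (x \<bullet>c x)"
    by (rule unitarily_diag_quadratic_form_le[OF A x(1)])
       (use carr in \<open>auto intro!: 0 simp: rs_def I_def\<close>)
  moreover have "Re ((B *\<^sub>v x) \<bullet>c x) \<le> t * Re (x \<bullet>c x)"
    by (rule unitarily_diag_quadratic_form_le[OF B x(1)])
       (use carr in \<open>auto intro!: 0 simp: rs_def I_def\<close>)
  moreover have "(s + t) * Re (x \<bullet>c x) < Re (((A + B) *\<^sub>v x) \<bullet>c x)"
    by (rule unitarily_diag_quadratic_form_gt[OF C x])
       (use carr in \<open>auto intro!: 0 simp: rs_def I_def\<close>)
  moreover have "((A + B) *\<^sub>v x) \<bullet>c x = (A *\<^sub>v x) \<bullet>c x + (B *\<^sub>v x) \<bullet>c x"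
    using unitarily_diagD(5)[OF A] unitarily_diagD(5)[OF B] x
    by (simp add: add_mult_distrib_mat_vec[of _ n n] add_scalar_prod_distrib[of _ n] mult_mat_vec_carrier[of _ n n])
  ultimately show False
    by (simp add: algebra_simps)
qed

text \<open>Weyl's inequality is applied to \<open>A + E\<close> and to
  \<open>A = (A + E) + (- E)\<close>. Counting the eigenvalues of \<open>E\<close> by modulus bounds
  the error in both directions.\<close>

lemma weyl_count_perturbation:
  assumes A: "unitarily_diag n A U a" and E: "unitarily_diag n E V e"
    and C: "unitarily_diag n (A + E) W c"
  shows "card {i. i < n \<and> t + h < c i} \<le> card {i. i < n \<and> t < a i} + card {i. i < n \<and> h < \<bar>e i\<bar>}"
    and "card {i. i < n \<and> t + h < a i} \<le> card {i. i < n \<and> t < c i} + card {i. i < n \<and> h < \<bar>e i\<bar>}"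
proof -
  have "card {i. i < n \<and> h < e i} \<le> card {i. i < n \<and> h < \<bar>e i\<bar>}"
    by (rule card_mono) auto
  then show "card {i. i < n \<and> t + h < c i} \<le> card {i. i < n \<and> t < a i} + card {i. i < n \<and> h < \<bar>e i\<bar>}"
    using weyl_count[OF A E C, of t h] by linarith
  have "card {i. i < n \<and> h < - e i} \<le> card {i. i < n \<and> h < \<bar>e i\<bar>}"
    by (rule card_mono) auto
  moreover have "A + E + (- E) = A"
    using unitarily_diagD(5)[OF A] unitarily_diagD(5)[OF E] by (intro eq_matI) auto
  ultimately show "card {i. i < n \<and> t + h < a i} \<le> card {i. i < n \<and> t < c i} + card {i. i < n \<and> h < \<bar>e i\<bar>}"
    using weyl_count[OF C unitarily_diag_uminus[OF E], of U a t h] A by simp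
qed

text \<open>For \<open>t 0 < x \<le> t K\<close> the jumps telescope to the value of
  \<open>f\<close> at the last grid point strictly to the left of \<open>x\<close>, which is at
  distance at most \<open>d\<close>. Elsewhere both functions vanish.\<close>

lemma step_function_approx:
  fixes f :: "real \<Rightarrow> complex" and t :: "nat \<Rightarrow> real"
  assumes t: "\<And>j. t (Suc j) = t j + d" and d: "0 < d"
    and f: "\<And>x y. \<bar>x - y\<bar> \<le> d \<Longrightarrow> cmod (f x - f y) \<le> w" and w: "0 \<le> w"
    and supp: "\<And>x. x \<le> t 0 \<Longrightarrow> f x = 0" "\<And>x. t K \<le> x \<Longrightarrow> f x = 0"
  shows "cmod (f x - (\<Sum>j<K. (f (t (Suc j)) - f (t j)) * of_bool (t (Suc j) < x))) \<le> w"
proof -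
  let ?s = "\<lambda>K x. \<Sum>j<K. (f (t (Suc j)) - f (t j)) * of_bool (t (Suc j) < x)"
  have t': "t j = t 0 + real j * d" for j
    by (induction j) (simp_all add: t algebra_simps)
  have mono: "i \<le> j \<Longrightarrow> t i \<le> t j" for i j
    using d by (simp add: t'[of i] t'[of j] mult_right_mono)
  have right: "?s K x = f (t K) - f (t 0)" if "t K < x" for K x
  proof -
    have "?s K x = (\<Sum>j<K. f (t (Suc j)) - f (t j))"
      using that mono[of "Suc _" K] by (intro sum.cong) (force simp: less_eq_Suc_le)+
    then show ?thesis
      by (simp add: sum_lessThan_telescope[of "\<lambda>j. f (t j)"])
  qed
  have mid: "cmod (f x - ?s K x) \<le> w" if "t 0 \<le> x" "x \<le> t K" for K x
    using that
  proof (induction K)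
    case 0
    then show ?case using supp(1)[of x] w by simp
  next
    case (Suc K)
    \<comment> \<open>The last jump sits at \<open>t (Suc K)\<close>, which \<open>x\<close> does
      not exceed, so the new grid cell adds nothing.\<close>
    then have eq: "?s (Suc K) x = ?s K x"
      by simp
    show ?case
    proof (cases "x \<le> t K")
      case True
      then show ?thesis using Suc eq by simp
    next
      case False
      then have "?s (Suc K) x = f (t K) - f (t 0)"
        unfolding eq using right by simp
      moreover have "\<bar>x - t K\<bar> \<le> d"
        using False Suc.prems t[of K] by simp
      ultimately show ?thesis
        using f[of x "t K"] supp(1)[of "t 0"] by simp
    qed
  qed
  consider "x < t 0" | "t 0 \<le> x" "x \<le> t K" | "t K < x"
    by linarith
  then show ?thesis
  proof cases
    case 1
    then have "\<not> t (Suc j) < x" for j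
      using mono[of 0 "Suc j"] by simp
    then show ?thesis
      using supp(1)[of x] 1 w by simp
  next
    case 2
    then show ?thesis by (rule mid)
  next
    case 3
    then show ?thesis
      using right[OF 3] supp(1)[of "t 0"] supp(2)[of "t K"] supp(2)[of x] w by simp
  qed
qed

text \<open>Replace \<open>f\<close> by a step function with jumps at equidistant points \<open>t j\<close>, whose sums are
  combinations of counts. The shift \<open>h\<close> is half the mesh, so the windows \<open>(t j - h, t j + h]\<close> are
  disjoint and the counts of \<open>a\<close> in them add up to at most \<open>n\<close>.\<close>

lemma sum_diff_le_counts:
  fixes f :: "real \<Rightarrow> complex"
  assumes cont: "continuous_on UNIV f" and bdd: "bounded {x. f x \<noteq> 0}" and e: "0 < e"
  obtains C h :: real where "0 < h" "0 \<le> C"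
    "\<And>n a b q. \<lbrakk>\<And>t. card {i. i < n \<and> t + h < b i} \<le> card {i. i < n \<and> t < a i} + q;
        \<And>t. card {i. i < n \<and> t + h < a i} \<le> card {i. i < n \<and> t < b i} + q\<rbrakk>
      \<Longrightarrow> cmod ((\<Sum>i<n. f (b i)) - (\<Sum>i<n. f (a i))) \<le> C * real q + e * real n"
proof -
  obtain R where R: "0 < R" "\<And>x. f x \<noteq> 0 \<Longrightarrow> \<bar>x\<bar> \<le> R"
    using bdd by (auto simp: bounded_pos)
  \<comment> \<open>Three errors of size \<open>w * n\<close> arise: replacing \<open>f\<close> by
    \<open>s\<close> for \<open>a\<close> and for \<open>b\<close>, and the total of the window
    counts.\<close>
  define w where "w = e / 3"
  have w: "0 < w"
    using e by (simp add: w_def)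
  have "uniformly_continuous_on {-R-2..R+2} f"
    by (intro compact_uniformly_continuous continuous_on_subset[OF cont]) auto
  then obtain d0 where d0: "0 < d0" "\<And>x y. \<lbrakk>x \<in> {-R-2..R+2}; y \<in> {-R-2..R+2}; \<bar>x - y\<bar> < d0\<rbrakk> \<Longrightarrow> cmod (f x - f y) < w"
    unfolding uniformly_continuous_on_def dist_norm real_norm_def using w by metis
  \<comment> \<open>The mesh is below the modulus of continuity on the interval. Being at most 1, it
    also ensures that when one of two points within distance \<open>d\<close> exceeds
    \<open>R + 1\<close> in modulus, \<open>f\<close> vanishes at both.\<close>
  define d where "d = min (d0 / 2) 1"
  have d: "0 < d" "d < d0" "d \<le> 1"
    using d0(1) by (auto simp: d_def)
  have fd: "cmod (f x - f y) \<le> w" if "\<bar>x - y\<bar> \<le> d" for x y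
  proof (cases "\<bar>x\<bar> \<le> R + 1 \<and> \<bar>y\<bar> \<le> R + 1")
    case True
    then show ?thesis
      using d0(2)[of x y] that d by (auto simp: abs_le_iff)
  next
    case False
    then have "R < \<bar>x\<bar>" "R < \<bar>y\<bar>"
      using that d by linarith+
    then have "f x = 0" "f y = 0"
      using R(2) by (meson not_le)+
    then show ?thesis
      using w by simp
  qed
  \<comment> \<open>The grid starts one unit to the left of \<open>-R\<close>; \<open>K\<close> is
    chosen so that it reaches at least \<open>R + 1\<close>.\<close>
  define t where "t j = - R - 1 + real j * d" for j :: nat
  have t: "t (Suc j) = t j + d" for j
    by (simp add: t_def algebra_simps)
  obtain K :: nat where "(2 * R + 2) / d \<le> real K"
    using real_arch_simple by blast
  then have tK: "R + 1 \<le> t K"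
    using d by (simp add: t_def field_simps)
  have supp: "f x = 0" if "x \<le> t 0 \<or> t K \<le> x" for x
  proof -
    have "R < \<bar>x\<bar>"
      using that tK R(1) by (auto simp: t_def)
    then show ?thesis
      using R(2) by (meson not_le)
  qed
  define h where "h = d / 2"
  define D where "D j = f (t (Suc j)) - f (t j)" for j
  define s where "s x = (\<Sum>j<K. D j * of_bool (t (Suc j) < x))" for x
  have fs: "cmod (f x - s x) \<le> w" for x
    unfolding s_def D_def
    by (rule step_function_approx[of t d]) (use t d fd w supp in auto)
  have D: "cmod (D j) \<le> w" for j
    using fd[of "t (Suc j)" "t j"] d by (simp add: D_def t)
  have bound: "cmod ((\<Sum>i<n. f (b i)) - (\<Sum>i<n. f (a i))) \<le> (w * K) * real q + e * real n"
    if ba: "\<And>t. card {i. i < n \<and> t + h < b i} \<le> card {i. i < n \<and> t < a i} + q"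
      and ab: "\<And>t. card {i. i < n \<and> t + h < a i} \<le> card {i. i < n \<and> t < b i} + q"
    for n q and a b :: "nat \<Rightarrow> real"
  proof -
    define N where "N c t = card {i. i < n \<and> t < c i}" for c :: "nat \<Rightarrow> real" and t
    have N_mono: "N c u \<le> N c v" if "v \<le> u" for c u v
      unfolding N_def using that by (intro card_mono) auto
    have sum_s: "(\<Sum>i<n. s (c i)) = (\<Sum>j<K. D j * of_nat (N c (t (Suc j))))" for c
    proof -
      have "(\<Sum>i<n. of_bool (u < c i)) = (of_nat (N c u) :: complex)" for u
        by (simp add: N_def sum.If_cases of_bool_def Int_def)
      then show ?thesis
        unfolding s_def by (subst sum.swap) (simp flip: sum_distrib_left)
    qed
    have sum_fs: "cmod ((\<Sum>i<n. f (c i)) - (\<Sum>i<n. s (c i))) \<le> w * n" for c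
    proof -
      have "cmod (\<Sum>i<n. f (c i) - s (c i)) \<le> (\<Sum>i<n. w)"
        by (intro sum_norm_le fs)
      then show ?thesis
        by (simp add: sum_subtractf mult.commute)
    qed
    \<comment> \<open>The two hypotheses squeeze \<open>N b u\<close> between
      \<open>N a (u + h) - q\<close> and \<open>N a (u - h) + q\<close>, and by monotonicity
      \<open>N a u\<close> lies between the two counts of \<open>a\<close>.\<close>
    have Ndiff: "\<bar>real (N b u) - real (N a u)\<bar> \<le> q + (real (N a (u - h)) - real (N a (u + h)))" for u
    proof -
      have "N b u \<le> N a (u - h) + q" "N a (u + h) \<le> N b u + q" "N a (u + h) \<le> N a u" "N a u \<le> N a (u - h)"
        using ba[of "u - h"] ab[of u] N_mono d by (simp_all add: N_def[symmetric] h_def)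
      then show ?thesis
        by linarith
    qed
    have "cmod ((\<Sum>i<n. s (b i)) - (\<Sum>i<n. s (a i)))
      = cmod (\<Sum>j<K. D j * of_real (real (N b (t (Suc j))) - real (N a (t (Suc j)))))"
      by (simp add: sum_s sum_subtractf right_diff_distrib)
    also have "\<dots> \<le> (\<Sum>j<K. w * (q + (real (N a (t (Suc j) - h)) - real (N a (t (Suc j) + h)))))"
    proof (rule sum_norm_le)
      fix j
      show "cmod (D j * of_real (real (N b (t (Suc j))) - real (N a (t (Suc j)))))
        \<le> w * (q + (real (N a (t (Suc j) - h)) - real (N a (t (Suc j) + h))))"
        unfolding norm_mult norm_of_real
        using D[of j] Ndiff[of "t (Suc j)"] w by (intro mult_mono) auto
    qed
    also have "\<dots> = w * K * q + w * (\<Sum>j<K. real (N a (t (Suc j) - h)) - real (N a (t (Suc (Suc j)) - h)))"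
    proof -
      \<comment> \<open>As \<open>d = 2 * h\<close>, each window ends where the next begins, so the
        sum of the window counts telescopes.\<close>
      have shift: "t (Suc j) + h = t (Suc (Suc j)) - h" for j
        by (simp add: t h_def)
      show ?thesis
        unfolding shift by (simp add: distrib_left sum.distrib sum_distrib_left mult_ac)
    qed
    also have "(\<Sum>j<K. real (N a (t (Suc j) - h)) - real (N a (t (Suc (Suc j)) - h))) 
        = real (N a (t (Suc 0) - h)) - real (N a (t (Suc K) - h))"
      by (rule sum_lessThan_telescope')
    also have "w * K * q + w * (real (N a (t (Suc 0) - h)) - real (N a (t (Suc K) - h))) \<le> w * K * q + w * n"
    proof -
      have "N a u \<le> n" for u
        unfolding N_def using card_mono[of "{..<n}" "{i. i < n \<and> u < a i}"] by auto
      then have "real (N a (t (Suc 0) - h)) - real (N a (t (Suc K) - h)) \<le> real n"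
        by (smt (verit) of_nat_0_le_iff of_nat_mono)
      then show ?thesis
        using w by simp
    qed
    finally have "cmod ((\<Sum>i<n. s (b i)) - (\<Sum>i<n. s (a i))) \<le> w * K * q + w * n" .
    moreover have "dist x y \<le> dist x u + dist u v + dist y v" for x y u v :: complex
      using dist_triangle[of x y u] dist_triangle[of u y v] by (simp add: dist_commute)
    note this[of "\<Sum>i<n. f (b i)" "\<Sum>i<n. f (a i)" "\<Sum>i<n. s (b i)" "\<Sum>i<n. s (a i)"]
    ultimately have "cmod ((\<Sum>i<n. f (b i)) - (\<Sum>i<n. f (a i))) \<le> w * K * q + 3 * w * n"
      using sum_fs[of a] sum_fs[of b] unfolding dist_norm by linarith
    then show ?thesis
      by (simp add: w_def)
  qed
  show thesis
    by (rule that[of h "w * K"]) (use bound w d in \<open>auto simp: h_def\<close>)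
qed

section \<open>Block antidiagonal matrices\<close>

lemma comm_ring_hom_pcompose: "comm_ring_hom (\<lambda>p::'a::comm_ring_1 poly. p \<circ>\<^sub>p q)"
  by unfold_locales (auto simp: pcompose_add pcompose_mult)

abbreviation const_mat :: "complex mat \<Rightarrow> complex poly mat" where
  "const_mat \<equiv> map_mat (\<lambda>a. [:a:])"

abbreviation X_mat :: "nat \<Rightarrow> complex poly mat" where
  "X_mat n \<equiv> [:0, 1:] \<cdot>\<^sub>m 1\<^sub>m n"

lemma const_mat_mult:
  assumes "A \<in> carrier_mat n m" "B \<in> carrier_mat m k"
  shows "const_mat (A * B) = const_mat A * const_mat B"
proof -
  interpret comm_ring_hom "\<lambda>a::complex. [:a:]"
    by unfold_locales (auto simp: one_pCons)
  show ?thesis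
    by (rule mat_hom_mult[OF assms])
qed

lemma char_poly_matrix_antidiagonal:
  assumes "A \<in> carrier_mat r c" "B \<in> carrier_mat c r"
  shows "char_poly_matrix (four_block_mat (0\<^sub>m r r) A B (0\<^sub>m c c))
    = four_block_mat (X_mat r) (- const_mat A) (- const_mat B) (X_mat c)"
  unfolding char_poly_matrix_def using assms
  by (intro eq_matI) auto

text \<open>\<open>[:0, 0, 1:]\<close> is the square of the variable \<open>[:0, 1:]\<close>.
  Substituting it is a ring homomorphism and hence commutes with the determinant of the
  characteristic matrix.\<close>

lemma det_char_poly_matrix_square:
  assumes "G \<in> carrier_mat n n"
  shows "det ([:0, 0, 1:] \<cdot>\<^sub>m 1\<^sub>m n + - const_mat G) = char_poly G \<circ>\<^sub>p [:0, 0, 1:]"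
proof -
  have "[:0, 0, 1:] \<cdot>\<^sub>m 1\<^sub>m n + - const_mat G
      = map_mat (\<lambda>p. p \<circ>\<^sub>p [:0, 0, 1:]) (char_poly_matrix G)"
    unfolding char_poly_matrix_def using assms
    by (intro eq_matI) (auto simp: pcompose_pCons)
  then show ?thesis
    by (simp add: comm_ring_hom.hom_det[OF comm_ring_hom_pcompose] char_poly_def)
qed

text \<open>The factor \<open>?T\<close> clears the upper right block of the characteristic matrix,
  leaving \<open>X\<close> and \<open>X^2 - B * A\<close> on the diagonal. Its determinant
  \<open>X^c\<close> is kept on the left, which avoids division.\<close>

lemma char_poly_antidiagonal_left:
  fixes A B :: "complex mat"
  assumes A: "A \<in> carrier_mat r c" and B: "B \<in> carrier_mat c r"
  shows "char_poly (four_block_mat (0\<^sub>m r r) A B (0\<^sub>m c c)) * [:0, 1:] ^ c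
    = [:0, 1:] ^ r * (char_poly (B * A) \<circ>\<^sub>p [:0, 0, 1:])"
proof -
  let ?M = "four_block_mat (X_mat r) (- const_mat A) (- const_mat B) (X_mat c)"
  let ?T = "four_block_mat (1\<^sub>m r) (const_mat A) (0\<^sub>m c r) (X_mat c)"
  have carr: "?M \<in> carrier_mat (r + c) (r + c)" "?T \<in> carrier_mat (r + c) (r + c)"
    by (intro four_block_carrier_mat; simp)+
  have "X_mat r * const_mat A + - const_mat A * X_mat c = 0\<^sub>m r c"
    using A by (intro eq_matI) auto
  moreover have "- const_mat B * const_mat A + X_mat c * X_mat c
      = [:0, 0, 1:] \<cdot>\<^sub>m 1\<^sub>m c + - const_mat (B * A)"
    using A B unfolding const_mat_mult[OF B A] by (intro eq_matI) auto
  ultimately have prod: "?M * ?T = four_block_mat (X_mat r) (0\<^sub>m r c) (- const_mat B)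
      ([:0, 0, 1:] \<cdot>\<^sub>m 1\<^sub>m c + - const_mat (B * A))"
    using A B by (subst mult_four_block_mat[of _ r r _ c _ c _ _ r _ c]) auto
  have "det ?M * det ?T = [:0, 1:] ^ r * (char_poly (B * A) \<circ>\<^sub>p [:0, 0, 1:])"
    unfolding det_mult[OF carr, symmetric] prod
    using A B by (subst det_four_block_mat_upper_right_zero[of _ r _ c])
      (auto simp: det_char_poly_matrix_square[of _ c] mult_carrier_mat[of _ c r])
  moreover have "det ?T = [:0, 1:] ^ c"
    using A by (subst det_four_block_mat_lower_left_zero[of _ r _ c]) auto
  ultimately show ?thesis
    by (simp add: char_poly_def char_poly_matrix_antidiagonal[OF A B])
qed

text \<open>The mirror image clears the lower left block and produces the product
  \<open>A * B\<close>. It serves matrices with more columns than rows, whose singular values are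
  defined by that Gram matrix.\<close>

lemma char_poly_antidiagonal_right:
  fixes A B :: "complex mat"
  assumes A: "A \<in> carrier_mat r c" and B: "B \<in> carrier_mat c r"
  shows "char_poly (four_block_mat (0\<^sub>m r r) A B (0\<^sub>m c c)) * [:0, 1:] ^ r
    = [:0, 1:] ^ c * (char_poly (A * B) \<circ>\<^sub>p [:0, 0, 1:])"
proof -
  let ?M = "four_block_mat (X_mat r) (- const_mat A) (- const_mat B) (X_mat c)"
  let ?T = "four_block_mat (X_mat r) (0\<^sub>m r c) (const_mat B) (1\<^sub>m c)"
  have carr: "?M \<in> carrier_mat (r + c) (r + c)" "?T \<in> carrier_mat (r + c) (r + c)"
    by (intro four_block_carrier_mat; simp)+
  have "- const_mat B * X_mat r + X_mat c * const_mat B = 0\<^sub>m c r"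
    using B by (intro eq_matI) auto
  moreover have "X_mat r * X_mat r + - const_mat A * const_mat B
      = [:0, 0, 1:] \<cdot>\<^sub>m 1\<^sub>m r + - const_mat (A * B)"
    using A B unfolding const_mat_mult[OF A B] by (intro eq_matI) auto
  ultimately have prod: "?M * ?T = four_block_mat ([:0, 0, 1:] \<cdot>\<^sub>m 1\<^sub>m r + - const_mat (A * B))
      (- const_mat A) (0\<^sub>m c r) (X_mat c)"
    using A B by (subst mult_four_block_mat[of _ r r _ c _ c _ _ r _ c]) auto
  have "det ?M * det ?T = (char_poly (A * B) \<circ>\<^sub>p [:0, 0, 1:]) * [:0, 1:] ^ c"
    unfolding det_mult[OF carr, symmetric] prod
    using A B by (subst det_four_block_mat_lower_left_zero[of _ r _ c])
      (auto simp: det_char_poly_matrix_square[of _ r] mult_carrier_mat[of _ r c])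
  moreover have "det ?T = [:0, 1:] ^ r"
    using B by (subst det_four_block_mat_upper_right_zero[of _ r _ c]) auto
  ultimately show ?thesis
    by (simp add: char_poly_def char_poly_matrix_antidiagonal[OF A B] mult.commute)
qed

text \<open>For \<open>l i \<ge> 0\<close> the factor \<open>X^2 - l i\<close> splits into linear
  factors with roots plus and minus \<open>sqrt (l i)\<close>.\<close>

lemma sum_proots_char_poly_square:
  fixes F :: "complex \<Rightarrow> complex"
  assumes G: "unitarily_diag n G U l" and nonneg: "\<And>i. i < n \<Longrightarrow> 0 \<le> l i"
  shows "char_poly G \<circ>\<^sub>p [:0, 0, 1:] \<noteq> 0" (is ?nz)
    and "(\<Sum>z\<in>#proots (char_poly G \<circ>\<^sub>p [:0, 0, 1:]). F z)
      = (\<Sum>i<n. F (of_real (sqrt (l i))) + F (- of_real (sqrt (l i))))" (is ?sum)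
proof -
  let ?s = "\<lambda>i. complex_of_real (sqrt (l i))"
  have "(\<Prod>i\<leftarrow>is. [:- of_real (l i), 1:]) \<circ>\<^sub>p [:0, 0, 1:] = (\<Prod>i\<leftarrow>is. [:- ?s i, 1:] * [:?s i, 1:])"
    if "set is \<subseteq> {..<n}" for "is"
    using that
  proof (induction "is")
    case (Cons i "is")
    have "?s i * ?s i = of_real (l i)"
      using Cons.prems nonneg[of i] by (simp flip: of_real_mult)
    then have "[:- of_real (l i), 1:] \<circ>\<^sub>p [:0, 0, 1:] = [:- ?s i, 1:] * [:?s i, 1:]"
      by (simp add: pcompose_pCons)
    then show ?case
      using Cons by (simp only: list.map prod_list.Cons pcompose_mult) simp
  qed (simp add: pcompose_1)
  then have eq: "char_poly G \<circ>\<^sub>p [:0, 0, 1:] = (\<Prod>i\<leftarrow>[0..<n]. [:- ?s i, 1:] * [:?s i, 1:])"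
    unfolding unitarily_diag_char_poly[OF G] by (simp only: atLeast_upt order_refl)
  have nz: "(\<Prod>i\<leftarrow>is. [:- ?s i, 1:] * [:?s i, 1:]) \<noteq> 0" for "is"
    by (induction "is") (simp_all del: mult_pCons_left mult_pCons_right)
  then show ?nz
    unfolding eq .
  have "(\<Sum>z\<in>#proots (\<Prod>i\<leftarrow>is. [:- ?s i, 1:] * [:?s i, 1:]). F z) = (\<Sum>i\<leftarrow>is. F (?s i) + F (- ?s i))" for "is"
  proof (induction "is")
    case (Cons i "is")
    have "proots (\<Prod>i\<leftarrow>i # is. [:- ?s i, 1:] * [:?s i, 1:])
        = {#?s i, - ?s i#} + proots (\<Prod>i\<leftarrow>is. [:- ?s i, 1:] * [:?s i, 1:])"
      unfolding list.map prod_list.Cons using nz[of "is"] proots_linear_factor[of "- ?s i"]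
      by (subst proots_mult) (simp_all add: proots_mult del: mult_pCons_left mult_pCons_right)
    then show ?case
      using Cons by (simp del: mult_pCons_left mult_pCons_right)
  qed simp
  from this[of "[0..<n]"] show ?sum
    unfolding eq by (simp add: sum_list_distinct_conv_sum_set atLeast_upt del: mult_pCons_left mult_pCons_right)
qed

text \<open>For the eigenvector \<open>x\<close> in column \<open>i\<close> of \<open>U\<close>, the
  value \<open>l i\<close> is the squared norm of \<open>A *\<^sub>v x\<close>.\<close>

lemma gram_matrix_nonneg:
  assumes A: "A \<in> carrier_mat r c" and G: "unitarily_diag c (mat_adjoint A * A) U l" and i: "i < c"
  shows "0 \<le> l i"
proof -
  note U = unitarily_diagD[OF G]
  define x where "x = U *\<^sub>v unit_vec c i"
  have x: "x \<in> carrier_vec c"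
    using U(1) by (simp add: x_def mult_mat_vec_carrier[of _ c c])
  have Ax: "A *\<^sub>v x \<in> carrier_vec r"
    using A x by (simp add: mult_mat_vec_carrier[of _ r c])
  have "mat_adjoint U *\<^sub>v x = unit_vec c i"
    using U(1,2) by (simp add: x_def flip: assoc_mult_mat_vec[of _ c c _ c])
  then have "Re (((mat_adjoint A * A) *\<^sub>v x) \<bullet>c x) = (\<Sum>j<c. l j * (cmod (unit_vec c i $ j))\<^sup>2)"
    using unitarily_diag_quadratic_form(1)[OF G x] by simp
  also have "\<dots> = (\<Sum>j<c. if j = i then l j else 0)"
    using i by (intro sum.cong) auto
  also have "\<dots> = l i"
    using i by simp
  finally have "l i = Re (((mat_adjoint A * A) *\<^sub>v x) \<bullet>c x)" ..
  also have "((mat_adjoint A * A) *\<^sub>v x) \<bullet>c x = (A *\<^sub>v x) \<bullet>c (A *\<^sub>v x)"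
    using mult_mat_vec_cscalar[of "mat_adjoint A" c r "A *\<^sub>v x" x] A x Ax
    by (simp add: assoc_mult_mat_vec[of _ c r _ c])
  also have "Re \<dots> \<ge> 0"
    using conjugate_square_ge_0_vec[of "A *\<^sub>v x"] by (simp add: less_eq_complex_def)
  finally show ?thesis .
qed

lemma hermitian_gram: "A \<in> carrier_mat r c \<Longrightarrow> hermitian_mat (mat_adjoint A * A)"
  by (auto simp: hermitian_mat_def mat_adjoint_mult[of _ c r _ c])

text \<open>Root multisets of both sides of the polynomial identity are compared. The powers of the
  variable contribute only zeros, and choosing the smaller Gram matrix makes their difference in
  number nonnegative.\<close>

theorem sum_eigenvalues_antidiagonal:
  fixes F :: "complex \<Rightarrow> complex"
  assumes A: "A \<in> carrier_mat r c"
  shows "(\<Sum>z\<in>#eigenvalues (four_block_mat (0\<^sub>m r r) A (mat_adjoint A) (0\<^sub>m c c)). F z)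
    = of_int \<bar>int r - int c\<bar> * F 0 + (\<Sum>s\<in>#singular_values A. F (of_real s) + F (- of_real s))"
proof -
  let ?M = "four_block_mat (0\<^sub>m r r) A (mat_adjoint A) (0\<^sub>m c c)"
  \<comment> \<open>A general \<open>H\<close> of size \<open>p \<times> q\<close> serves both
    cases: \<open>H = A\<close> if \<open>c \<le> r\<close>, and \<open>H = mat_adjoint A\<close>
    otherwise.\<close>
  have *: "(\<Sum>z\<in>#eigenvalues ?M. F z) = of_int (int p - int q) * F 0
      + (\<Sum>s\<in>#image_mset (\<lambda>z. sqrt (Re z)) (eigenvalues (mat_adjoint H * H)). F (of_real s) + F (- of_real s))"
    if H: "H \<in> carrier_mat p q"
      and eq: "char_poly ?M * [:0, 1:] ^ q = [:0, 1:] ^ p * (char_poly (mat_adjoint H * H) \<circ>\<^sub>p [:0, 0, 1:])"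
    for H p q
  proof -
    have "mat_adjoint H * H \<in> carrier_mat q q"
      using H by (simp add: mult_carrier_mat[of _ q p])
    then obtain U l where G: "unitarily_diag q (mat_adjoint H * H) U l"
      using hermitian_unitarily_diag hermitian_gram[OF H] by blast
    note nonneg = gram_matrix_nonneg[OF H G]
    note sq = sum_proots_char_poly_square[OF G nonneg]
    have X: "proots ([:0, 1:] ^ k :: complex poly) = replicate_mset k 0" for k
      using proots_linear_factor[of "0::complex"] by (simp add: proots_power)
    have "char_poly ?M \<noteq> 0"
      using eq sq(1) by auto
    then have "eigenvalues ?M + replicate_mset q 0
        = replicate_mset p 0 + proots (char_poly (mat_adjoint H * H) \<circ>\<^sub>p [:0, 0, 1:])"
      using arg_cong[OF eq, of proots] sq(1) by (simp add: proots_mult X eigenvalues_def)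
    from arg_cong[OF this, of "\<lambda>m. \<Sum>z\<in>#m. F z"]
    have "(\<Sum>z\<in>#eigenvalues ?M. F z) + of_nat q * F 0
        = of_nat p * F 0 + (\<Sum>i<q. F (of_real (sqrt (l i))) + F (- of_real (sqrt (l i))))"
      by (simp add: sq(2))
    then show ?thesis
      by (simp add: unitarily_diag_eigenvalues[OF G] image_mset.compositionality o_def sum_mset_upt algebra_simps
          del: mset_upt)
  qed
  show ?thesis
  proof (cases "c \<le> r")
    case True
    then show ?thesis
      using *[OF A char_poly_antidiagonal_left[OF A]] A by (simp add: singular_values_def)
  next
    case False
    then show ?thesis
      using *[of "mat_adjoint A" c r] char_poly_antidiagonal_right[OF A, of "mat_adjoint A"] A
      by (simp add: singular_values_def)
  qed
qed

section \<open>Integrals over a set and its translate\<close>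

text \<open>Translation is the affine map with all scaling factors 1, so its Jacobian factor is
  1.\<close>

lemma distr_lebesgue_translation:
  fixes p :: "'a::euclidean_space"
  shows "(+) p \<in> lebesgue \<rightarrow>\<^sub>M lebesgue" and "distr lebesgue lebesgue ((+) p) = lebesgue"
proof -
  have T: "(\<lambda>x. p + (\<Sum>j\<in>Basis. (1 * inner x j) *\<^sub>R j)) = (+) p"
    by (simp add: euclidean_representation)
  show "(+) p \<in> lebesgue \<rightarrow>\<^sub>M lebesgue"
    using lebesgue_affine_measurable[of "\<lambda>_. 1" p] unfolding T by simp
  have "lebesgue = density (distr lebesgue lebesgue ((+) p)) (\<lambda>_. 1)"
    using lebesgue_affine_euclidean[of "\<lambda>_. 1" p] unfolding T by simp
  then show "distr lebesgue lebesgue ((+) p) = lebesgue"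
    by (simp add: density_1)
qed

lemma borel_measurable_lebesgue_translation:
  fixes f :: "'a::euclidean_space \<Rightarrow> 'b::topological_space"
  assumes "f \<in> borel_measurable lebesgue"
  shows "(\<lambda>x. f (x - p)) \<in> borel_measurable lebesgue"
  using measurable_compose[OF distr_lebesgue_translation(1)[of "- p"] assms] by simp

lemma lebesgue_integral_translation:
  fixes f :: "'a::euclidean_space \<Rightarrow> 'b::{banach, second_countable_topology}"
  assumes f: "f \<in> borel_measurable lebesgue"
  shows "(LINT x|lebesgue. f (x - p)) = (LINT x|lebesgue. f x)"
  using integral_distr[OF distr_lebesgue_translation(1)[of "- p"] f]
  by (simp add: distr_lebesgue_translation(2))

lemma lebesgue_integrable_translation:
  fixes f :: "'a::euclidean_space \<Rightarrow> 'b::{banach, second_countable_topology}"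
  assumes f: "integrable lebesgue f"
  shows "integrable lebesgue (\<lambda>x. f (x - p))"
  using integrable_distr_eq[OF distr_lebesgue_translation(1)[of "- p"], of f] f
  by (simp add: distr_lebesgue_translation(2))

text \<open>The closure of the bounded set where \<open>F\<close> is nonzero is compact, so the
  continuous \<open>F\<close> is bounded there. This makes test functions integrable over sets of
  finite measure.\<close>

lemma Cc_bounded:
  fixes F :: "'a::heine_borel \<Rightarrow> complex"
  assumes "F \<in> Cc"
  obtains C where "0 \<le> C" "\<And>z. cmod (F z) \<le> C"
proof -
  let ?S = "closure {z. F z \<noteq> 0}"
  have "compact (F ` ?S)"
    using assms by (intro compact_continuous_image) (auto simp: Cc_def intro: continuous_on_subset)
  then obtain C where C: "0 < C" "\<And>w. w \<in> F ` ?S \<Longrightarrow> cmod w \<le> C"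
    using compact_imp_bounded bounded_pos by metis
  have "cmod (F z) \<le> C" for z
  proof (cases "F z = 0")
    case False
    then have "z \<in> ?S"
      using closure_subset[of "{z. F z \<noteq> 0}"] by blast
    then show ?thesis
      using C(2) by blast
  qed (use C(1) in simp)
  then show thesis
    using that[of C] C(1) by simp
qed

text \<open>Translation preserves measure, so the doubled measure of the union forces the overlap to
  be null. Up to it, \<open>psi\<close> is \<open>g\<close> on \<open>D\<close> and the translate of
  \<open>-g\<close> on the shifted copy, and translation invariance brings the second integral back
  to \<open>D\<close>.\<close>

lemma integral_psi:
  fixes D :: "(real^'k) set" and F :: "complex \<Rightarrow> complex"
  assumes D: "D \<in> lmeasurable"
    and double: "measure lebesgue (D \<union> (+) p ` D) = 2 * measure lebesgue D"
    and g: "g \<in> borel_measurable (lebesgue_on D)" and F: "F \<in> Cc"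
  shows "(LINT x|lebesgue_on (D \<union> (+) p ` D). F (complex_of_real (psi D p g x)))
    = (LINT x|lebesgue_on D. F (of_real (g x)) + F (- of_real (g x)))"
proof -
  have Dp: "(+) p ` D \<in> lmeasurable"
    using D by (rule measurable_translation)
  have sets: "D \<in> sets lebesgue" "(+) p ` D \<in> sets lebesgue"
    using D Dp by auto
  have mem: "x \<in> (+) p ` D \<longleftrightarrow> x - p \<in> D" for x
    by (auto simp: image_iff algebra_simps intro: bexI[of _ "x - p"])
  have "measure lebesgue (D \<inter> (+) p ` D) = 0"
    using measure_Un3[OF D Dp] double measure_translation[of p D] by simp
  moreover have DDp: "D \<inter> (+) p ` D \<in> lmeasurable"
    using D Dp by (rule fmeasurable.Int)
  ultimately have null: "D \<inter> (+) p ` D \<in> null_sets lebesgue"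
    by (intro null_setsI) (simp_all add: emeasure_eq_measure2 fmeasurableD)
  obtain C where C: "\<And>z. cmod (F z) \<le> C"
    using Cc_bounded[OF F] by blast
  have Fm: "F \<in> borel_measurable borel"
    using F by (auto simp: Cc_def intro: borel_measurable_continuous_onI)
  have int: "integrable (lebesgue_on D) (\<lambda>x. F (of_real (s * g x)))" for s
  proof (rule finite_measure.integrable_const_bound[of _ _ C])
    show "finite_measure (lebesgue_on D)"
      using D by (rule finite_measure_lebesgue_on)
    show "(\<lambda>x. F (of_real (s * g x))) \<in> borel_measurable (lebesgue_on D)"
      by (rule measurable_compose[OF _ Fm]) (use g in measurable)
  qed (use C in simp)
  \<comment> \<open>Extension by zero turns integrals over \<open>D\<close> into integrals over the
    whole space, where translation invariance applies; \<open>s\<close> will be 1 or -1.\<close>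
  define u where "u s x = indicator D x *\<^sub>R F (of_real (s * g x))" for s x
  have u: "integrable lebesgue (u s)" for s
    using int[of s] sets by (simp add: integrable_restrict_space u_def[abs_def])
  have um: "u s \<in> borel_measurable lebesgue" for s
    using u by (rule borel_measurable_integrable)
  have "(LINT x|lebesgue_on (D \<union> (+) p ` D). F (complex_of_real (psi D p g x)))
      = (LINT x|lebesgue. indicator (D \<union> (+) p ` D) x *\<^sub>R F (complex_of_real (psi D p g x)))"
    using sets by (intro integral_restrict_space) auto
  also have "\<dots> = (LINT x|lebesgue. u 1 x + indicator (- D) x *\<^sub>R u (-1) (x - p))"
    by (intro Bochner_Integration.integral_cong refl)
       (auto simp: u_def psi_def mem split: split_indicator)
  also have "\<dots> = (LINT x|lebesgue. u 1 x + u (-1) (x - p))"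
  proof (rule integral_cong_AE)
    show "AE x in lebesgue. u 1 x + indicator (- D) x *\<^sub>R u (-1) (x - p) = u 1 x + u (-1) (x - p)"
      using AE_not_in[OF null] by eventually_elim (auto simp: u_def mem split: split_indicator)
    have "indicat_real (- D) \<in> borel_measurable lebesgue"
      using sets by (intro borel_measurable_indicator) (auto simp: Compl_in_sets_lebesgue)
    then show "(\<lambda>x. u 1 x + indicator (- D) x *\<^sub>R u (-1) (x - p)) \<in> borel_measurable lebesgue"
      using um borel_measurable_lebesgue_translation[OF um] by (intro borel_measurable_add borel_measurable_scaleR)
    show "(\<lambda>x. u 1 x + u (-1) (x - p)) \<in> borel_measurable lebesgue"
      using um borel_measurable_lebesgue_translation[OF um] by (intro borel_measurable_add)
  qed
  also have "\<dots> = (LINT x|lebesgue. u 1 x) + (LINT x|lebesgue. u (-1) x)"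
    using u lebesgue_integrable_translation[OF u]
    by (simp add: lebesgue_integral_translation[OF um])
  also have "\<dots> = (LINT x|lebesgue_on D. F (of_real (1 * g x))) + (LINT x|lebesgue_on D. F (of_real (-1 * g x)))"
    using sets by (simp add: integral_restrict_space u_def)
  also have "\<dots> = (LINT x|lebesgue_on D. F (of_real (1 * g x)) + F (of_real (-1 * g x)))"
    by (rule Bochner_Integration.integral_add[symmetric]) (rule int)+
  finally show ?thesis
    by simp
qed

section \<open>Asymptotic distributions\<close>

text \<open>As \<open>E\<close> is its own adjoint, its Gram matrix is \<open>E * E\<close> with
  eigenvalues \<open>(e i)\<^sup>2\<close>, whose square roots are the moduli.\<close>

lemma singular_values_hermitian:
  assumes E: "unitarily_diag n E V e" and herm: "hermitian_mat E"
  shows "singular_values E = image_mset (\<lambda>i. \<bar>e i\<bar>) (mset [0..<n])"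
proof -
  note V = unitarily_diagD[OF E]
  let ?D = "real_diag_mat n e"
  have D2: "?D * ?D = real_diag_mat n (\<lambda>i. (e i)\<^sup>2)"
    by (intro eq_matI)
       (auto simp: real_diag_mat_def scalar_prod_def if_distrib[of "\<lambda>z. z * _"] power2_eq_square cong: if_cong)
  have "E * E = V * ?D * (mat_adjoint V * V) * ?D * mat_adjoint V"
    unfolding V(4) using V(1) by (simp add: assoc_mult_mat[of _ n n _ n _ n] mult_carrier_mat[of _ n n _ n])
  also have "\<dots> = V * (?D * ?D) * mat_adjoint V"
    using V(1) by (simp add: V(2) assoc_mult_mat[of _ n n _ n _ n] mult_carrier_mat[of _ n n _ n])
  finally have "unitarily_diag n (E * E) V (\<lambda>i. (e i)\<^sup>2)"
    unfolding unitarily_diag_def using V D2 by simp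
  from unitarily_diag_eigenvalues[OF this] show ?thesis
    using herm V(5) by (simp add: singular_values_def hermitian_mat_def image_mset.compositionality o_def)
qed

text \<open>For the tent function \<open>G\<close> with peak 1 at 0 and support in
  \<open>[-h, h]\<close>, the function \<open>1 - G\<close> dominates the indicator of moduli above
  \<open>h\<close>. The average of \<open>G\<close> tends to \<open>G 0 = 1\<close>, so the
  proportion is squeezed to zero.\<close>

lemma large_eigenvalues_negligible:
  fixes D :: "(real^'k) set"
  assumes D: "D \<in> lmeasurable" "0 < measure lebesgue D"
    and E: "\<And>n. 0 < n \<Longrightarrow> unitarily_diag n (E n) (V n) (e n)"
    and herm: "\<And>n. 0 < n \<Longrightarrow> hermitian_mat (E n)"
    and distr: "singular_value_distr E D (\<lambda>_. 0)" and h: "0 < h"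
  shows "(\<lambda>n. real (card {i. i < n \<and> h < \<bar>e n i\<bar>}) / real n) \<longlonglongrightarrow> 0"
proof -
  define G where "G s = complex_of_real (max 0 (1 - \<bar>s\<bar> / h))" for s :: real
  have "{s. G s \<noteq> 0} \<subseteq> {-h..h}"
    using h by (auto simp: G_def max_def field_simps split: if_splits)
  then have GC: "G \<in> Cc"
    unfolding Cc_def G_def using h
    by (auto intro!: continuous_intros intro: bounded_subset[OF bounded_closed_interval])
  have G1: "(LINT x|lebesgue_on D. G (cmod 0)) / of_real (measure lebesgue D) = 1"
    using D by (simp add: G_def measure_restrict_space scaleR_conv_of_real)
  have "(\<lambda>n. (\<Sum>s\<in>#singular_values (E n). G s) / of_nat (min (dim_row (E n)) (dim_col (E n)))) \<longlonglongrightarrow> 1"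
    using distr GC unfolding singular_value_distr_def G1[symmetric] by blast
  moreover have "\<forall>\<^sub>F n in sequentially. (\<Sum>s\<in>#singular_values (E n). G s) / of_nat (min (dim_row (E n)) (dim_col (E n)))
      = (\<Sum>i<n. G \<bar>e n i\<bar>) / of_nat n"
    using eventually_gt_at_top[of 0]
  proof eventually_elim
    case (elim n)
    have "E n \<in> carrier_mat n n"
      using unitarily_diagD(5)[OF E[OF elim]] .
    then show ?case
      using singular_values_hermitian[OF E herm] elim
      by (simp add: image_mset.compositionality o_def sum_mset_upt del: mset_upt)
  qed
  ultimately have "(\<lambda>n. (\<Sum>i<n. G \<bar>e n i\<bar>) / of_nat n) \<longlonglongrightarrow> 1"
    by (rule Lim_transform_eventually)
  then have "(\<lambda>n. 1 - Re ((\<Sum>i<n. G \<bar>e n i\<bar>) / of_nat n)) \<longlonglongrightarrow> 1 - Re 1"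
    by (intro tendsto_intros)
  then have lim: "(\<lambda>n. 1 - Re ((\<Sum>i<n. G \<bar>e n i\<bar>) / of_nat n)) \<longlonglongrightarrow> 0"
    by simp
  show ?thesis
  proof (rule tendsto_sandwich[OF _ _ tendsto_const lim])
    show "\<forall>\<^sub>F n in sequentially. real (card {i. i < n \<and> h < \<bar>e n i\<bar>}) / real n \<le> 1 - Re ((\<Sum>i<n. G \<bar>e n i\<bar>) / of_nat n)"
      using eventually_gt_at_top[of 0]
    proof eventually_elim
      case (elim n)
      have "real (card {i. i < n \<and> h < \<bar>e n i\<bar>}) = (\<Sum>i<n. of_bool (h < \<bar>e n i\<bar>))"
        by (simp add: sum.If_cases of_bool_def Int_def)
      also have "\<dots> \<le> (\<Sum>i<n. 1 - Re (G \<bar>e n i\<bar>))"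
        using h by (intro sum_mono) (auto simp: G_def max_def field_simps)
      also have "\<dots> = real n - Re (\<Sum>i<n. G \<bar>e n i\<bar>)"
        by (simp add: sum_subtractf)
      finally have "real (card {i. i < n \<and> h < \<bar>e n i\<bar>}) / real n \<le> (real n - Re (\<Sum>i<n. G \<bar>e n i\<bar>)) / real n"
        by (intro divide_right_mono) auto
      also have "\<dots> = 1 - Re ((\<Sum>i<n. G \<bar>e n i\<bar>) / of_nat n)"
        using elim by (simp add: diff_divide_distrib Re_divide_of_nat)
      finally show ?case .
    qed
  qed auto
qed

text \<open>The second function is the one used to test the singular values of \<open>A\<close>,
  since each singular value \<open>s\<close> yields the eigenvalue pair \<open>s\<close>,
  \<open>-s\<close>.\<close>

lemma Cc_of_real_comp:
  fixes F :: "complex \<Rightarrow> complex"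
  assumes F: "F \<in> Cc"
  shows "(\<lambda>s. F (of_real s)) \<in> Cc" and "(\<lambda>s. F (of_real s) + F (- of_real s)) \<in> Cc"
proof -
  have cont: "continuous_on UNIV F"
    using F by (simp add: Cc_def)
  obtain R where R: "\<And>z. F z \<noteq> 0 \<Longrightarrow> cmod z \<le> R"
    using F by (auto simp: Cc_def bounded_iff)
  have "continuous_on UNIV (\<lambda>s. F (of_real s))" "continuous_on UNIV (\<lambda>s. F (- of_real s))"
    by (auto intro!: continuous_on_compose2[OF cont] continuous_intros)
  moreover have "bounded {s. F (of_real s) \<noteq> 0}"
    using R[of "of_real _"] by (intro boundedI[of _ R]) fastforce
  moreover have "bounded {s. F (of_real s) + F (- of_real s) \<noteq> 0}"
  proof (rule boundedI[of _ R])
    fix s assume "s \<in> {s. F (of_real s) + F (- of_real s) \<noteq> 0}"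
    then have "F (of_real s) \<noteq> 0 \<or> F (- of_real s) \<noteq> 0"
      by auto
    then show "norm s \<le> R"
      using R[of "of_real s"] R[of "- of_real s"] by auto
  qed
  ultimately show "(\<lambda>s. F (of_real s)) \<in> Cc" "(\<lambda>s. F (of_real s) + F (- of_real s)) \<in> Cc"
    by (auto simp: Cc_def intro!: continuous_on_add)
qed

text \<open>This makes the two block sizes, whose shifts by \<open>k n\<close> cancel, add up to
  \<open>n\<close>.\<close>

lemma ceiling_half_nat: "\<lceil>real n / 2\<rceil> = int n - \<lfloor>real n / 2\<rfloor>"
  by linarith

lemma hermitian_antidiagonal:
  assumes "A \<in> carrier_mat r c"
  shows "hermitian_mat (four_block_mat (0\<^sub>m r r) A (mat_adjoint A) (0\<^sub>m c c))"
  unfolding hermitian_mat_def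
proof
  show "mat_adjoint (four_block_mat (0\<^sub>m r r) A (mat_adjoint A) (0\<^sub>m c c))
      = four_block_mat (0\<^sub>m r r) A (mat_adjoint A) (0\<^sub>m c c)"
    using assms by (intro eq_matI) auto
qed (use assms in simp)

text \<open>Weyl's inequality supplies the count hypotheses of \<open>sum_diff_le_counts\<close>,
  with \<open>q\<close> the number of eigenvalues of \<open>E n\<close> of modulus above
  \<open>h\<close>. As \<open>C\<close> and \<open>h\<close> do not depend on \<open>n\<close>, the
  term \<open>C * q\<close> is \<open>o(n)\<close>.\<close>

lemma hermitian_perturbation_sum_diff:
  fixes F :: "complex \<Rightarrow> complex"
  assumes F: "F \<in> Cc"
    and spec: "\<forall>\<^sub>F n in sequentially. unitarily_diag n (M n) (U n) (a n) \<and>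
      unitarily_diag n (E n) (V n) (e n) \<and> unitarily_diag n (M n + E n) (W n) (b n)"
    and small: "\<And>h. 0 < h \<Longrightarrow> (\<lambda>n. real (card {i. i < n \<and> h < \<bar>e n i\<bar>}) / real n) \<longlonglongrightarrow> 0"
  shows "(\<lambda>n. ((\<Sum>i<n. F (of_real (b n i))) - (\<Sum>i<n. F (of_real (a n i)))) / of_nat n) \<longlonglongrightarrow> 0"
proof (rule tendstoI)
  fix \<epsilon> :: real assume \<epsilon>: "0 < \<epsilon>"
  define f where "f s = F (of_real s)" for s
  have f: "continuous_on UNIV f" "bounded {s. f s \<noteq> 0}"
    using Cc_of_real_comp(1)[OF F] by (simp_all add: f_def[abs_def] Cc_def)
  have "0 < \<epsilon> / 2"
    using \<epsilon> by simp
  from f this obtain C h :: real where h: "0 < h" "0 \<le> C" and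
    le: "\<And>n a b q. \<lbrakk>\<And>t. card {i. i < n \<and> t + h < b i} \<le> card {i. i < n \<and> t < a i} + q;
        \<And>t. card {i. i < n \<and> t + h < a i} \<le> card {i. i < n \<and> t < b i} + q\<rbrakk>
      \<Longrightarrow> cmod ((\<Sum>i<n. f (b i)) - (\<Sum>i<n. f (a i))) \<le> C * real q + \<epsilon> / 2 * real n"
    by (rule sum_diff_le_counts) (rule that; blast)
  have "(\<lambda>n. C * (real (card {i. i < n \<and> h < \<bar>e n i\<bar>}) / real n)) \<longlonglongrightarrow> C * 0"
    by (intro tendsto_intros small h)
  then have "\<forall>\<^sub>F n in sequentially. C * (real (card {i. i < n \<and> h < \<bar>e n i\<bar>}) / real n) < \<epsilon> / 2"
    using \<epsilon> by (intro order_tendstoD) auto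
  with spec show "\<forall>\<^sub>F n in sequentially.
      dist (((\<Sum>i<n. F (of_real (b n i))) - (\<Sum>i<n. F (of_real (a n i)))) / of_nat n) 0 < \<epsilon>"
    using eventually_gt_at_top[of 0]
  proof eventually_elim
    case (elim n)
    let ?q = "card {i. i < n \<and> h < \<bar>e n i\<bar>}"
    have "cmod ((\<Sum>i<n. f (b n i)) - (\<Sum>i<n. f (a n i))) \<le> C * real ?q + \<epsilon> / 2 * real n"
      using elim by (intro le weyl_count_perturbation[of n "M n" "U n" "a n" "E n" "V n" "e n" "W n" "b n"]) auto
    then have "cmod ((\<Sum>i<n. f (b n i)) - (\<Sum>i<n. f (a n i))) / real n \<le> (C * real ?q + \<epsilon> / 2 * real n) / real n"
      by (intro divide_right_mono) auto
    also have "\<dots> = C * (real ?q / real n) + \<epsilon> / 2"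
      using elim by (simp add: add_divide_distrib)
    also have "\<dots> < \<epsilon>"
      using elim(2) by linarith
    finally show ?case
      by (simp add: f_def norm_divide)
  qed
qed

theorem theorem3p1:
  fixes D :: "(real^'k) set" and p :: "real^'k" and g :: "real^'k \<Rightarrow> real"
    and k :: "nat \<Rightarrow> int" and A B E :: "nat \<Rightarrow> complex mat"
  assumes D_meas: "D \<in> sets lebesgue"
    and D_pos: "0 < emeasure lebesgue D" and D_fin: "emeasure lebesgue D < \<infinity>"
    and disj: "interior D \<inter> interior ((+) p ` D) = {}"
    and double: "measure lebesgue (D \<union> (+) p ` D) = 2 * measure lebesgue D"
    and g_meas: "g \<in> borel_measurable (lebesgue_on D)"
    and g_nonneg: "\<And>x. x \<in> D \<Longrightarrow> 0 \<le> g x"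
    and k_small: "(\<lambda>n. real_of_int (k n)) \<in> o(\<lambda>n. real n)"
    and B_herm: "\<And>n. 0 < n \<Longrightarrow> B n \<in> carrier_mat n n \<and> hermitian_mat (B n)"
    and E_herm: "\<And>n. 0 < n \<Longrightarrow> E n \<in> carrier_mat n n \<and> hermitian_mat (E n)"
    and A_dim: "\<And>n r c. \<lbrakk>0 < r; 0 < c; int r = \<lceil>real n / 2\<rceil> + k n; int c = \<lfloor>real n / 2\<rfloor> - k n\<rbrakk>
      \<Longrightarrow> A n \<in> carrier_mat r c"
    and B_eq: "\<And>n r c. \<lbrakk>0 < r; 0 < c; int r = \<lceil>real n / 2\<rceil> + k n; int c = \<lfloor>real n / 2\<rfloor> - k n\<rbrakk>
      \<Longrightarrow> B n = four_block_mat (0\<^sub>m r r) (A n) (mat_adjoint (A n)) (0\<^sub>m c c) + E n"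
    and A_distr: "singular_value_distr A D (\<lambda>x. complex_of_real (g x))"
    and E_distr: "singular_value_distr E D (\<lambda>_. 0)"
  shows "eigenvalue_distr B (D \<union> (+) p ` D) (\<lambda>x. complex_of_real (psi D p g x))"
  unfolding eigenvalue_distr_def
proof
  fix F :: "complex \<Rightarrow> complex" assume F: "F \<in> Cc"
  have D: "D \<in> lmeasurable"
    using D_meas D_fin by (intro fmeasurableI) auto
  have D0: "0 < measure lebesgue D"
    using D_pos D by (simp add: emeasure_eq_measure2)
  \<comment> \<open>\<open>nat\<close> would truncate a negative block size to 0; \<open>rc\<close>
    shows that for large \<open>n\<close> both sizes are positive, so nothing is truncated.\<close>
  define r where "r n = nat (\<lceil>real n / 2\<rceil> + k n)" for n
  define c where "c n = nat (\<lfloor>real n / 2\<rfloor> - k n)" for n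
  have k0: "(\<lambda>n. real_of_int (k n) / real n) \<longlonglongrightarrow> 0"
    using k_small by (rule smalloD_tendsto)
  have rc: "\<forall>\<^sub>F n in sequentially. 0 < n \<and> 0 < r n \<and> 0 < c n \<and> r n + c n = n \<and>
      int (r n) = \<lceil>real n / 2\<rceil> + k n \<and> int (c n) = \<lfloor>real n / 2\<rfloor> - k n"
  proof -
    \<comment> \<open>With \<open>\<bar>k n\<bar>\<close> at most \<open>n / 4\<close>, each block
      size exceeds \<open>n / 4 - 1\<close>, which is positive for \<open>n > 8\<close>.\<close>
    have "\<forall>\<^sub>F n in sequentially. \<bar>real_of_int (k n)\<bar> \<le> 1 / 4 * \<bar>real n\<bar>"
      using landau_o.smallD[OF k_small, of "1 / 4"] by simp
    then show ?thesis
      using eventually_gt_at_top[of 8]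
    proof eventually_elim
      case (elim n)
      have "0 < \<lceil>real n / 2\<rceil> + k n" "0 < \<lfloor>real n / 2\<rfloor> - k n"
        using elim by linarith+
      then show ?case
        using elim ceiling_half_nat[of n] by (simp add: r_def c_def)
    qed
  qed
  \<comment> \<open>The proportion of additional zeros among the eigenvalues of the matrix
    \<open>M n\<close> defined below.\<close>
  define \<delta> where "\<delta> n = real_of_int \<bar>int (r n) - int (c n)\<bar> / real n" for n
  have \<delta>: "\<delta> \<longlonglongrightarrow> 0"
  proof (rule tendsto_sandwich[OF _ _ tendsto_const])
    have "(\<lambda>n. 2 * \<bar>real_of_int (k n) / real n\<bar> + 1 / real n) \<longlonglongrightarrow> 2 * \<bar>0\<bar> + 0"
      by (intro tendsto_intros k0 lim_1_over_n)
    then show "(\<lambda>n. 2 * \<bar>real_of_int (k n) / real n\<bar> + 1 / real n) \<longlonglongrightarrow> 0"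
      by simp
    show "\<forall>\<^sub>F n in sequentially. \<delta> n \<le> 2 * \<bar>real_of_int (k n) / real n\<bar> + 1 / real n"
      using rc
    proof eventually_elim
      case (elim n)
      \<comment> \<open>The shifts contribute \<open>2 * k n\<close>, and ceiling and floor of
        \<open>n / 2\<close> differ by at most 1.\<close>
      have "\<bar>int (r n) - int (c n)\<bar> \<le> 2 * \<bar>k n\<bar> + 1"
        using elim by linarith
      then have "real_of_int \<bar>int (r n) - int (c n)\<bar> \<le> real_of_int (2 * \<bar>k n\<bar> + 1)"
        by (simp only: of_int_le_iff)
      then have "\<delta> n \<le> real_of_int (2 * \<bar>k n\<bar> + 1) / real n"
        unfolding \<delta>_def by (intro divide_right_mono) auto
      then show ?case
        by (simp add: add_divide_distrib)
    qed
  qed (simp add: \<delta>_def)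
  define M where "M n = four_block_mat (0\<^sub>m (r n) (r n)) (A n) (mat_adjoint (A n)) (0\<^sub>m (c n) (c n))" for n
  have "\<forall>n. \<exists>U l. 0 < n \<longrightarrow> unitarily_diag n (E n) U l"
    using hermitian_unitarily_diag E_herm by blast
  then obtain V e where E: "\<And>n. 0 < n \<Longrightarrow> unitarily_diag n (E n) (V n) (e n)"
    by metis
  have "\<forall>n. \<exists>U l. 0 < n \<longrightarrow> unitarily_diag n (B n) U l"
    using hermitian_unitarily_diag B_herm by blast
  then obtain W b where B: "\<And>n. 0 < n \<Longrightarrow> unitarily_diag n (B n) (W n) (b n)"
    by metis
  have A: "\<forall>\<^sub>F n in sequentially. A n \<in> carrier_mat (r n) (c n)"
    using rc by eventually_elim (use A_dim in blast)
  have "\<forall>n. \<exists>U a. A n \<in> carrier_mat (r n) (c n) \<and> r n + c n = n \<longrightarrow> unitarily_diag n (M n) U a"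
  proof
    fix n
    show "\<exists>U a. A n \<in> carrier_mat (r n) (c n) \<and> r n + c n = n \<longrightarrow> unitarily_diag n (M n) U a"
    proof (cases "A n \<in> carrier_mat (r n) (c n) \<and> r n + c n = n")
      case True
      have "M n \<in> carrier_mat (r n + c n) (r n + c n)"
        unfolding M_def by (intro four_block_carrier_mat) auto
      then show ?thesis
        using hermitian_unitarily_diag[of "M n" n] hermitian_antidiagonal[of "A n" "r n" "c n"] True
        by (auto simp: M_def)
    qed auto
  qed
  then obtain U a where M: "\<And>n. A n \<in> carrier_mat (r n) (c n) \<Longrightarrow> r n + c n = n \<Longrightarrow> unitarily_diag n (M n) (U n) (a n)"
    by metis
  have BME: "\<forall>\<^sub>F n in sequentially. B n = M n + E n"
    using rc by eventually_elim (use B_eq in \<open>auto simp: M_def\<close>)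
  have diff: "(\<lambda>n. ((\<Sum>i<n. F (of_real (b n i))) - (\<Sum>i<n. F (of_real (a n i)))) / of_nat n) \<longlonglongrightarrow> 0"
  proof (rule hermitian_perturbation_sum_diff[OF F])
    show "\<forall>\<^sub>F n in sequentially. unitarily_diag n (M n) (U n) (a n) \<and>
        unitarily_diag n (E n) (V n) (e n) \<and> unitarily_diag n (M n + E n) (W n) (b n)"
      using rc A BME by eventually_elim (metis M E B)
    show "(\<lambda>n. real (card {i. i < n \<and> h < \<bar>e n i\<bar>}) / real n) \<longlonglongrightarrow> 0" if "0 < h" for h
      using large_eigenvalues_negligible[OF D D0 E _ E_distr that] E_herm by blast
  qed
  define G where "G s = F (of_real s) + F (- of_real s)" for s :: real
  define q where "q n = (\<Sum>s\<in>#singular_values (A n). G s) / of_nat (min (dim_row (A n)) (dim_col (A n)))" for n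
  have "G \<in> Cc"
    using Cc_of_real_comp(2)[OF F] by (simp add: G_def[abs_def])
  then have S: "q \<longlonglongrightarrow>
      (LINT x|lebesgue_on D. G (cmod (of_real (g x)))) / of_real (measure lebesgue D)"
    using A_distr unfolding singular_value_distr_def q_def[abs_def] by blast
  \<comment> \<open>Since \<open>g\<close> is nonnegative on \<open>D\<close>, the modulus in the
    limit for singular values can be removed.\<close>
  have "(LINT x|lebesgue_on D. G (cmod (of_real (g x)))) = (LINT x|lebesgue_on D. G (g x))"
    by (intro Bochner_Integration.integral_cong refl) (simp add: g_nonneg)
  also have "\<dots> = (LINT x|lebesgue_on (D \<union> (+) p ` D). F (complex_of_real (psi D p g x)))"
    using integral_psi[OF D double g_meas F] by (simp add: G_def)
  finally have I: "(LINT x|lebesgue_on D. G (cmod (of_real (g x))))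
      = (LINT x|lebesgue_on (D \<union> (+) p ` D). F (complex_of_real (psi D p g x)))" .
  let ?L = "(LINT x|lebesgue_on (D \<union> (+) p ` D). F (complex_of_real (psi D p g x)))"
  \<comment> \<open>The average for \<open>B n\<close> splits into the additional zeros of
    \<open>M n\<close>, the singular values of \<open>A n\<close> and the perturbation error. The
    weight \<open>(1 - \<delta> n) / 2\<close> is \<open>min (r n) (c n) / n\<close>; its limit 1/2
    matches the doubling of the measure.\<close>
  have lim: "(\<lambda>n. of_real (\<delta> n) * F 0 + of_real ((1 - \<delta> n) / 2) * q n
      + ((\<Sum>i<n. F (of_real (b n i))) - (\<Sum>i<n. F (of_real (a n i)))) / of_nat n)
      \<longlonglongrightarrow> of_real 0 * F 0 + of_real ((1 - 0) / 2) * (?L / of_real (measure lebesgue D)) + 0"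
    using S unfolding I by (intro tendsto_intros \<delta> diff) auto
  have eq: "of_real 0 * F 0 + of_real ((1 - 0) / 2) * (?L / of_real (measure lebesgue D)) + 0
      = ?L / of_real (measure lebesgue (D \<union> (+) p ` D))"
    by (simp add: double)
  have ev: "\<forall>\<^sub>F n in sequentially. of_real (\<delta> n) * F 0 + of_real ((1 - \<delta> n) / 2) * q n
      + ((\<Sum>i<n. F (of_real (b n i))) - (\<Sum>i<n. F (of_real (a n i)))) / of_nat n
      = (\<Sum>z\<in>#eigenvalues (B n). F z) / of_nat n"
    using rc A
  proof eventually_elim
    case (elim n)
    let ?T = "\<Sum>s\<in>#singular_values (A n). G s" and ?m = "min (r n) (c n)"
    \<comment> \<open>As \<open>r n + c n = n\<close>, removing the difference of the two sizes
      leaves twice the smaller one.\<close>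
    have eq: "real n - real_of_int \<bar>int (r n) - int (c n)\<bar> = 2 * real ?m"
      using elim by (auto simp: min_def of_nat_diff abs_if)
    have "(1 - x / y) / 2 = m / y" if "y - x = 2 * m" "0 < y" for x y m :: real
      using that by (simp add: field_simps)
    from this[OF eq] have "(1 - \<delta> n) / 2 = real ?m / real n"
      using elim by (simp add: \<delta>_def del: of_int_abs)
    moreover have "q n = ?T / of_nat ?m"
      using elim by (simp add: q_def)
    \<comment> \<open>This rescales the average from \<open>m\<close> singular values to
      \<open>n\<close> eigenvalues; cancelling \<open>m\<close> is why both block sizes have to be
      positive.\<close>
    moreover have "complex_of_real (real m / real n) * (z / of_nat m) = z / of_nat n" if "0 < m" for m z
      using that by simp
    ultimately have "of_real ((1 - \<delta> n) / 2) * q n = ?T / of_nat n"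
      using elim by (simp only: min_less_iff_conj)
    moreover have "(\<Sum>i<n. F (of_real (a n i))) = of_int \<bar>int (r n) - int (c n)\<bar> * F 0 + ?T"
    proof -
      have "(\<Sum>i<n. F (of_real (a n i))) = (\<Sum>z\<in>#eigenvalues (M n). F z)"
        using unitarily_diag_eigenvalues[OF M] elim
        by (simp add: image_mset.compositionality o_def sum_mset_upt del: mset_upt)
      then show ?thesis
        using elim sum_eigenvalues_antidiagonal[of "A n" "r n" "c n" F] by (simp add: M_def G_def)
    qed
    moreover have "(\<Sum>z\<in>#eigenvalues (B n). F z) = (\<Sum>i<n. F (of_real (b n i)))"
      using unitarily_diag_eigenvalues[OF B] elim
      by (simp add: image_mset.compositionality o_def sum_mset_upt del: mset_upt)
    moreover have "of_real (\<delta> n) * F 0 = of_int \<bar>int (r n) - int (c n)\<bar> * F 0 / of_nat n"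
      by (simp add: \<delta>_def del: of_int_abs)
    ultimately show ?case
      using elim by (simp add: add_divide_distrib diff_divide_distrib)
  qed
  show "(\<lambda>n. (\<Sum>z\<in>#eigenvalues (B n). F z) / of_nat n) \<longlonglongrightarrow>
      ?L / of_real (measure lebesgue (D \<union> (+) p ` D))"
    using Lim_transform_eventually[OF lim[unfolded eq] ev] .
qed

end
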